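(* Let $X$ be a metric space, $A\subseteq X$ a subspace, and $G$ any abelian group. Then the $lc$-cohomology sequence of the pair $(X,A)$ $$\cdots\to H^n_{lc}(X;G)\to H^n_{lc}(A;G)\to H^{n+1}_{lc}(X,A;G)\to H^{n+1}_{lc}(X;G)\to\cdots$$ with coefficients in $G$ is exact.
   Context: Given $\epsilon>0$, a map $g:X\to Y$ between metric spaces is $\epsilon$-continuous if there exists $\delta>0$ such that $\sup\{d_Y(g(x_1),g(x_2)) : d_X(x_1,x_2)<\delta\}<\epsilon$. Let $\Delta^n\subset\mathbb{R}^{n+1}$ be the standard $n$-simplex with its Euclidean metric. An $\epsilon$-singular $n$-simplex of $X$ is an $\epsilon$-continuous map $\sigma:\Delta^n\to X$. $C_n^{\epsilon}(X)$ is the free abelian group on all $\epsilon$-singular $n$-simplices, with the usual singular boundary operator $\partial_n\sigma=\sum_{i=0}^n(-1)^i\sigma|[v_0,\dots,\hat v_i,\dots,v_n]$. For a subspace $A\subseteq X$ (restricted metric), $C_n^{\epsilon}(X,A)=C_n^{\epsilon}(X)/C_n^{\epsilon}(A)$ with the induced boundary operator. $\epsilon$-cohomology: $C^n_\epsilon(X;G)=\operatorname{Hom}(C_n^\epsilon(X),G)$ and $C^n_\epsilon(X,A;G)=\operatorname{Hom}(C_n^\epsilon(X,A),G)$ with coboundary $\delta\varphi=\varphi\circ\partial$; $H^n_\epsilon(X;G)$ and $H^n_\epsilon(X,A;G)$ are the cohomology groups of these cochain complexes. For each $\epsilon$, the short exact sequence $0\to C_*^\epsilon(A)\to C_*^\epsilon(X)\to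 C_*^\epsilon(X,A)\to0$ gives, after applying $\operatorname{Hom}(-,G)$, a long sequence $\cdots\to H^n_\epsilon(X;G)\to H^n_\epsilon(A;G)\to H^{n+1}_\epsilon(X,A;G)\to H^{n+1}_\epsilon(X;G)\to\cdots$. $lc$-cohomology: for $0<\mu\le\epsilon$ the inclusion $C_*^\mu\hookrightarrow C_*^\epsilon$ induces homomorphisms from $H^n_\epsilon$ to $H^n_\mu$ (absolute and relative). $H^n_{lc}(X;G)$, $H^n_{lc}(A;G)$ and $H^n_{lc}(X,A;G)$ are the direct limits of these systems as $\epsilon\to0^+$. The maps in the $lc$-cohomology sequence are the direct limits of the maps in the $\epsilon$-cohomology sequences. *)

theory Defs
  imports "HOL-Analysis.Analysis" "HOL-Homology.Homology"
begin

section \<open>Cochain complexes and cohomology of integer-graded chain complexes\<close>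

record 'c chain_complex =
  chains :: "int \<Rightarrow> 'c monoid"
  bdry :: "int \<Rightarrow> 'c \<Rightarrow> 'c"  \<comment> \<open>in degree \<open>n\<close>, from \<open>n\<close>-chains to \<open>(n - 1)\<close>-chains\<close>

text \<open>Homomorphisms are taken extensional, so that equality of functions is equality on the carrier.\<close>

definition hom_group :: "'c monoid \<Rightarrow> 'g monoid \<Rightarrow> ('c \<Rightarrow> 'g) monoid" where
  "hom_group C G =
     \<lparr>carrier = hom C G \<inter> extensional (carrier C),
      monoid.mult = (\<lambda>\<phi> \<psi>. \<lambda>x\<in>carrier C. \<phi> x \<otimes>\<^bsub>G\<^esub> \<psi> x),
      one = (\<lambda>x\<in>carrier C. \<one>\<^bsub>G\<^esub>)\<rparr>"

definition cochains :: "'c chain_complex \<Rightarrow> 'g monoid \<Rightarrow> int \<Rightarrow> ('c \<Rightarrow> 'g) monoid" where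
  "cochains C G n = hom_group (chains C n) G"

definition coboundary :: "'c chain_complex \<Rightarrow> int \<Rightarrow> ('c \<Rightarrow> 'g) \<Rightarrow> 'c \<Rightarrow> 'g" where
  "coboundary C n \<phi> = compose (carrier (chains C (n + 1))) \<phi> (bdry C (n + 1))"

definition cocycles :: "'c chain_complex \<Rightarrow> 'g monoid \<Rightarrow> int \<Rightarrow> ('c \<Rightarrow> 'g) set" where
  "cocycles C G n = kernel (cochains C G n) (cochains C G (n + 1)) (coboundary C n)"

definition coboundaries :: "'c chain_complex \<Rightarrow> 'g monoid \<Rightarrow> int \<Rightarrow> ('c \<Rightarrow> 'g) set" where
  "coboundaries C G n = coboundary C (n - 1) ` carrier (cochains C G (n - 1))"

definition cohomology :: "'c chain_complex \<Rightarrow> 'g monoid \<Rightarrow> int \<Rightarrow> ('c \<Rightarrow> 'g) set monoid" where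
  "cohomology C G n = (cochains C G n)\<lparr>carrier := cocycles C G n\<rparr> Mod coboundaries C G n"

text \<open>The map on cosets induced by \<open>h\<close>. The argument \<open>c\<close> is a coset; when \<open>h\<close> respects the
  subgroups, all members of the union are the same coset of \<open>N\<close>.\<close>

definition coset_map :: "'b monoid \<Rightarrow> 'b set \<Rightarrow> ('a \<Rightarrow> 'b) \<Rightarrow> 'a set \<Rightarrow> 'b set" where
  "coset_map K N h c = (\<Union>z\<in>c. N #>\<^bsub>K\<^esub> h z)"

text \<open>\<open>f\<close> is a chain map from \<open>C\<close>; the induced maps go from cochains, respectively cohomology,
  of its codomain to those of \<open>C\<close>.\<close>

definition cochain_map ::
    "'c chain_complex \<Rightarrow> (int \<Rightarrow> 'c \<Rightarrow> 'd) \<Rightarrow> int \<Rightarrow> ('d \<Rightarrow> 'g) \<Rightarrow> 'c \<Rightarrow> 'g" where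
  "cochain_map C f n \<phi> = compose (carrier (chains C n)) \<phi> (f n)"

definition cohomology_map ::
    "'c chain_complex \<Rightarrow> 'g monoid \<Rightarrow> (int \<Rightarrow> 'c \<Rightarrow> 'd) \<Rightarrow> int \<Rightarrow> ('d \<Rightarrow> 'g) set \<Rightarrow> ('c \<Rightarrow> 'g) set" where
  "cohomology_map C G f n = coset_map (cochains C G n) (coboundaries C G n) (cochain_map C f n)"

definition quotient_complex :: "'c chain_complex \<Rightarrow> 'c chain_complex \<Rightarrow> 'c set chain_complex" where
  "quotient_complex C D =
     \<lparr>chains = (\<lambda>n. chains C n Mod carrier (chains D n)),
      bdry = (\<lambda>n. coset_map (chains C (n - 1)) (carrier (chains D (n - 1))) (bdry C n))\<rparr>"

definition quotient_proj :: "'c chain_complex \<Rightarrow> 'c chain_complex \<Rightarrow> int \<Rightarrow> 'c \<Rightarrow> 'c set" where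
  "quotient_proj C D n x = carrier (chains D n) #>\<^bsub>chains C n\<^esub> x"

text \<open>The connecting homomorphism of \<open>0 \<rightarrow> D \<rightarrow> C \<rightarrow> C/D \<rightarrow> 0\<close> after applying \<open>Hom(-,G)\<close>, where \<open>D\<close>
  is a subcomplex of \<open>C\<close>: extend a cocycle \<open>\<phi>\<close> on \<open>D\<close> to a cochain \<open>\<eta>\<close> on \<open>C\<close> and take the cocycle
  \<open>\<psi>\<close> on \<open>C/D\<close> that pulls back to the coboundary of \<open>\<eta>\<close>. The set of all \<open>\<psi>\<close> obtained from a
  cohomology class in this way is a full cohomology class.\<close>

definition connecting_hom ::
    "'c chain_complex \<Rightarrow> 'c chain_complex \<Rightarrow> 'g monoid \<Rightarrow> int \<Rightarrow>
     ('c \<Rightarrow> 'g) set \<Rightarrow> ('c set \<Rightarrow> 'g) set" where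
  "connecting_hom C D G n c =
     {\<psi> \<in> cocycles (quotient_complex C D) G (n + 1).
        \<exists>\<phi>\<in>c. \<exists>\<eta>\<in>carrier (cochains C G n).
          cochain_map D (\<lambda>_. id) n \<eta> = \<phi> \<and>
          coboundary C n \<eta> = cochain_map C (quotient_proj C D) (n + 1) \<psi>}"


section \<open>Direct limits of groups\<close>

text \<open>\<open>dir\<close> directs the index set \<open>I\<close>, and \<open>t i j\<close> is the transition map from \<open>K i\<close> to \<open>K j\<close>
  for \<open>dir i j\<close>.\<close>

definition direct_limit_rel ::
    "'i set \<Rightarrow> ('i \<Rightarrow> 'i \<Rightarrow> bool) \<Rightarrow> ('i \<Rightarrow> 'a monoid) \<Rightarrow> ('i \<Rightarrow> 'i \<Rightarrow> 'a \<Rightarrow> 'a) \<Rightarrow>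
     (('i \<times> 'a) \<times> ('i \<times> 'a)) set" where
  "direct_limit_rel I dir K t =
     {((i, x), (j, y)). i \<in> I \<and> j \<in> I \<and> x \<in> carrier (K i) \<and> y \<in> carrier (K j) \<and>
        (\<exists>k\<in>I. dir i k \<and> dir j k \<and> t i k x = t j k y)}"

definition direct_limit ::
    "'i set \<Rightarrow> ('i \<Rightarrow> 'i \<Rightarrow> bool) \<Rightarrow> ('i \<Rightarrow> 'a monoid) \<Rightarrow> ('i \<Rightarrow> 'i \<Rightarrow> 'a \<Rightarrow> 'a) \<Rightarrow>
     ('i \<times> 'a) set monoid" where
  "direct_limit I dir K t =
     \<lparr>carrier = (SIGMA i:I. carrier (K i)) // direct_limit_rel I dir K t,
      monoid.mult = (\<lambda>P Q. {w. \<exists>(i, x)\<in>P. \<exists>(j, y)\<in>Q. \<exists>k\<in>I. dir i k \<and> dir j k \<and>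
                       ((k, t i k x \<otimes>\<^bsub>K k\<^esub> t j k y), w) \<in> direct_limit_rel I dir K t}),
      one = {w. \<exists>i\<in>I. ((i, \<one>\<^bsub>K i\<^esub>), w) \<in> direct_limit_rel I dir K t}\<rparr>"

text \<open>The limit of a family \<open>h\<close> of maps; \<open>L\<close> and \<open>t\<close> are the groups and transition maps
  of the codomain.\<close>

definition direct_limit_map ::
    "'i set \<Rightarrow> ('i \<Rightarrow> 'i \<Rightarrow> bool) \<Rightarrow> ('i \<Rightarrow> 'b monoid) \<Rightarrow> ('i \<Rightarrow> 'i \<Rightarrow> 'b \<Rightarrow> 'b) \<Rightarrow>
     ('i \<Rightarrow> 'a \<Rightarrow> 'b) \<Rightarrow> ('i \<times> 'a) set \<Rightarrow> ('i \<times> 'b) set" where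
  "direct_limit_map I dir L t h P =
     {w. \<exists>(i, x)\<in>P. ((i, h i x), w) \<in> direct_limit_rel I dir L t}"


section \<open>The singular complex of almost continuous simplices\<close>

text \<open>The supremum is taken in the extended reals, so that it is infinite for an unbounded set.\<close>

definition eps_continuous ::
    "real \<Rightarrow> 'x set \<Rightarrow> ('x \<Rightarrow> 'x \<Rightarrow> real) \<Rightarrow> ('y \<Rightarrow> 'y \<Rightarrow> real) \<Rightarrow> ('x \<Rightarrow> 'y) \<Rightarrow> bool" where
  "eps_continuous \<epsilon> X dX dY g \<longleftrightarrow>
     (\<exists>\<delta>>0. Sup {ereal (dY (g x1) (g x2)) | x1 x2. x1 \<in> X \<and> x2 \<in> X \<and> dX x1 x2 < \<delta>} < ereal \<epsilon>)"

text \<open>The library represents points of the standard \<open>n\<close>-simplex as functions on \<open>nat\<close> that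
  vanish above \<open>n\<close>; this is their Euclidean distance in the coordinates \<open>0, \<dots>, n\<close>.\<close>

definition simplex_dist :: "nat \<Rightarrow> (nat \<Rightarrow> real) \<Rightarrow> (nat \<Rightarrow> real) \<Rightarrow> real" where
  "simplex_dist n x y = L2_set (\<lambda>i. x i - y i) {..n}"

definition eps_singular_simplices ::
    "'a set \<Rightarrow> ('a \<Rightarrow> 'a \<Rightarrow> real) \<Rightarrow> real \<Rightarrow> nat \<Rightarrow> ((nat \<Rightarrow> real) \<Rightarrow> 'a) set" where
  "eps_singular_simplices X d \<epsilon> n =
     {\<sigma> \<in> standard_simplex n \<rightarrow>\<^sub>E X.
        eps_continuous \<epsilon> (standard_simplex n) (simplex_dist n) d \<sigma>}"

definition eps_complex ::
    "'a set \<Rightarrow> ('a \<Rightarrow> 'a \<Rightarrow> real) \<Rightarrow> real \<Rightarrow> 'a chain chain_complex" where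
  "eps_complex X d \<epsilon> =
     \<lparr>chains = (\<lambda>n. free_Abelian_group (if n < 0 then {} else eps_singular_simplices X d \<epsilon> (nat n))),
      bdry = (\<lambda>n. chain_boundary (nat n))\<rparr>"

definition eps_rel_complex ::
    "'a set \<Rightarrow> 'a set \<Rightarrow> ('a \<Rightarrow> 'a \<Rightarrow> real) \<Rightarrow> real \<Rightarrow> 'a chain set chain_complex" where
  "eps_rel_complex X A d \<epsilon> = quotient_complex (eps_complex X d \<epsilon>) (eps_complex A d \<epsilon>)"


section \<open>The \<open>lc\<close>-cohomology sequence of a pair\<close>

text \<open>The map of the \<open>\<epsilon>\<close>- to the \<open>\<mu>\<close>-cohomology induced by the inclusion of \<open>\<mu>\<close>-chains in
  \<open>\<epsilon>\<close>-chains. In the absolute case the inclusion is the identity on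
  underlying functions, so \<open>\<epsilon>\<close> does not occur on the right-hand side.\<close>

definition eps_transition ::
    "'a set \<Rightarrow> ('a \<Rightarrow> 'a \<Rightarrow> real) \<Rightarrow> 'g monoid \<Rightarrow> int \<Rightarrow> real \<Rightarrow> real \<Rightarrow>
     ('a chain \<Rightarrow> 'g) set \<Rightarrow> ('a chain \<Rightarrow> 'g) set" where
  "eps_transition X d G n \<epsilon> \<mu> = cohomology_map (eps_complex X d \<mu>) G (\<lambda>_. id) n"

definition eps_rel_transition ::
    "'a set \<Rightarrow> 'a set \<Rightarrow> ('a \<Rightarrow> 'a \<Rightarrow> real) \<Rightarrow> 'g monoid \<Rightarrow> int \<Rightarrow> real \<Rightarrow> real \<Rightarrow>
     ('a chain set \<Rightarrow> 'g) set \<Rightarrow> ('a chain set \<Rightarrow> 'g) set" where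
  "eps_rel_transition X A d G n \<epsilon> \<mu> =
     cohomology_map (eps_rel_complex X A d \<mu>) G
       (\<lambda>m. coset_map (chains (eps_complex X d \<epsilon>) m) (carrier (chains (eps_complex A d \<epsilon>) m)) id) n"

text \<open>The index set is directed by \<open>\<ge>\<close>: the limit is taken as \<open>\<epsilon>\<close> decreases to \<open>0\<close>.\<close>

definition lc_cohomology ::
    "'a set \<Rightarrow> ('a \<Rightarrow> 'a \<Rightarrow> real) \<Rightarrow> 'g monoid \<Rightarrow> int \<Rightarrow>
     (real \<times> ('a chain \<Rightarrow> 'g) set) set monoid" where
  "lc_cohomology X d G n =
     direct_limit {0<..} (\<ge>) (\<lambda>\<epsilon>. cohomology (eps_complex X d \<epsilon>) G n) (eps_transition X d G n)"

definition lc_rel_cohomology ::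
    "'a set \<Rightarrow> 'a set \<Rightarrow> ('a \<Rightarrow> 'a \<Rightarrow> real) \<Rightarrow> 'g monoid \<Rightarrow> int \<Rightarrow>
     (real \<times> ('a chain set \<Rightarrow> 'g) set) set monoid" where
  "lc_rel_cohomology X A d G n =
     direct_limit {0<..} (\<ge>) (\<lambda>\<epsilon>. cohomology (eps_rel_complex X A d \<epsilon>) G n)
       (eps_rel_transition X A d G n)"

definition lc_restriction ::
    "'a set \<Rightarrow> ('a \<Rightarrow> 'a \<Rightarrow> real) \<Rightarrow> 'g monoid \<Rightarrow> int \<Rightarrow>
     (real \<times> ('a chain \<Rightarrow> 'g) set) set \<Rightarrow> (real \<times> ('a chain \<Rightarrow> 'g) set) set" where
  "lc_restriction A d G n =
     direct_limit_map {0<..} (\<ge>) (\<lambda>\<epsilon>. cohomology (eps_complex A d \<epsilon>) G n) (eps_transition A d G n)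
       (\<lambda>\<epsilon>. cohomology_map (eps_complex A d \<epsilon>) G (\<lambda>_. id) n)"

definition lc_from_rel ::
    "'a set \<Rightarrow> 'a set \<Rightarrow> ('a \<Rightarrow> 'a \<Rightarrow> real) \<Rightarrow> 'g monoid \<Rightarrow> int \<Rightarrow>
     (real \<times> ('a chain set \<Rightarrow> 'g) set) set \<Rightarrow> (real \<times> ('a chain \<Rightarrow> 'g) set) set" where
  "lc_from_rel X A d G n =
     direct_limit_map {0<..} (\<ge>) (\<lambda>\<epsilon>. cohomology (eps_complex X d \<epsilon>) G n) (eps_transition X d G n)
       (\<lambda>\<epsilon>. cohomology_map (eps_complex X d \<epsilon>) G
              (quotient_proj (eps_complex X d \<epsilon>) (eps_complex A d \<epsilon>)) n)"

definition lc_connecting ::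
    "'a set \<Rightarrow> 'a set \<Rightarrow> ('a \<Rightarrow> 'a \<Rightarrow> real) \<Rightarrow> 'g monoid \<Rightarrow> int \<Rightarrow>
     (real \<times> ('a chain \<Rightarrow> 'g) set) set \<Rightarrow> (real \<times> ('a chain set \<Rightarrow> 'g) set) set" where
  "lc_connecting X A d G n =
     direct_limit_map {0<..} (\<ge>) (\<lambda>\<epsilon>. cohomology (eps_rel_complex X A d \<epsilon>) G (n + 1))
       (eps_rel_transition X A d G (n + 1))
       (\<lambda>\<epsilon>. connecting_hom (eps_complex X d \<epsilon>) (eps_complex A d \<epsilon>) G n)"

text \<open>The library's \<open>exact_seq\<close> requires all groups to be of the same type, which fails here.\<close>

definition exact_at ::
    "'a monoid \<Rightarrow> ('a \<Rightarrow> 'b) \<Rightarrow> 'b monoid \<Rightarrow> ('b \<Rightarrow> 'c) \<Rightarrow> 'c monoid \<Rightarrow> bool" where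
  "exact_at K f L g M \<longleftrightarrow>
     group_hom K L f \<and> group_hom L M g \<and> f ` carrier K = kernel L M g"

end

theory Submission
  imports Defs
begin

text \<open>Fix \<open>\<epsilon>\<close>. The group \<open>C\<^sup>\<epsilon>\<^sub>n(A)\<close> is free on a subset of the basis of \<open>C\<^sup>\<epsilon>\<^sub>n(X)\<close>, hence a direct
  summand, so \<open>0 \<rightarrow> Hom(C(X)/C(A), G) \<rightarrow> Hom(C(X), G) \<rightarrow> Hom(C(A), G) \<rightarrow> 0\<close> is exact for every \<open>G\<close>, and it
  is a short exact sequence of cochain complexes (\<open>retract_subcomplex.cochain_ses\<close>). The snake
  argument turns it into a long exact sequence of cohomology groups (\<open>exact_at_L\<close>, \<open>exact_at_M\<close>
  and \<open>exact_at_K\<close> in the locale \<open>cochain_ses\<close>).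

  As \<open>\<epsilon>\<close> decreases, the inclusions of chain complexes map these short exact sequences to one
  another, so all maps of the long exact sequences commute with the transition maps; for the
  connecting homomorphism this is \<open>connecting_natural\<close>. Finally, direct limits of groups over a
  directed set preserve exactness (\<open>exact_at_direct_limit\<close>), because an equation that holds in
  the limit already holds at some index.

  The geometry enters only through two facts: faces of \<open>\<epsilon>\<close>-continuous simplices are
  \<open>\<epsilon>\<close>-continuous with the same \<open>\<epsilon>\<close>, since face inclusions are isometries, so that the boundary
  operator is defined on \<open>C\<^sup>\<epsilon>\<close>; and the
  \<open>\<mu>\<close>-simplices of \<open>A\<close> are \<open>\<epsilon>\<close>-simplices of \<open>X\<close> for \<open>\<mu> \<le> \<epsilon>\<close>.\<close>

section \<open>Direct limits of groups\<close>

locale directed_system =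
  fixes I :: "'i set" and dir :: "'i \<Rightarrow> 'i \<Rightarrow> bool"
    and K :: "'i \<Rightarrow> 'a monoid" and t :: "'i \<Rightarrow> 'i \<Rightarrow> 'a \<Rightarrow> 'a"
  assumes nonempty: "I \<noteq> {}"
    and dir_trans: "dir i j \<Longrightarrow> dir j k \<Longrightarrow> dir i k"
    and upper_bound: "i \<in> I \<Longrightarrow> j \<in> I \<Longrightarrow> \<exists>k\<in>I. dir i k \<and> dir j k"
    and group: "i \<in> I \<Longrightarrow> group (K i)"
    and t_hom: "i \<in> I \<Longrightarrow> j \<in> I \<Longrightarrow> dir i j \<Longrightarrow> t i j \<in> hom (K i) (K j)"
    and t_comp: "i \<in> I \<Longrightarrow> j \<in> I \<Longrightarrow> k \<in> I \<Longrightarrow> dir i j \<Longrightarrow> dir j k \<Longrightarrow> x \<in> carrier (K i)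
      \<Longrightarrow> t j k (t i j x) = t i k x"
begin

abbreviation "limit \<equiv> direct_limit I dir K t"

text \<open>The class of \<open>x \<in> K i\<close> in the limit.\<close>

definition germ :: "'i \<Rightarrow> 'a \<Rightarrow> ('i \<times> 'a) set" where
  "germ i x = direct_limit_rel I dir K t `` {(i, x)}"

lemma t_closed:
  "i \<in> I \<Longrightarrow> j \<in> I \<Longrightarrow> dir i j \<Longrightarrow> x \<in> carrier (K i) \<Longrightarrow> t i j x \<in> carrier (K j)"
  using t_hom hom_in_carrier by metis

lemma t_group_hom:
  "i \<in> I \<Longrightarrow> j \<in> I \<Longrightarrow> dir i j \<Longrightarrow> group_hom (K i) (K j) (t i j)"
  by (simp add: group_hom_def group_hom_axioms_def group t_hom)

lemma rel_later:
  assumes "i \<in> I" "j \<in> I" "k \<in> I" "l \<in> I" "x \<in> carrier (K i)" "y \<in> carrier (K j)"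
    and "dir i k" "dir j k" "dir k l" "t i k x = t j k y"
  shows "t i l x = t j l y"
  using assms by (metis t_comp)

lemma equiv_rel:
  "equiv (SIGMA i:I. carrier (K i)) (direct_limit_rel I dir K t)"
proof (rule equivI)
  show "direct_limit_rel I dir K t \<subseteq> (SIGMA i:I. carrier (K i)) \<times> (SIGMA i:I. carrier (K i))"
    by (auto simp: direct_limit_rel_def)
  show "refl_on (SIGMA i:I. carrier (K i)) (direct_limit_rel I dir K t)"
    using upper_bound by (auto simp: direct_limit_rel_def refl_on_def) 
  show "sym (direct_limit_rel I dir K t)"
    by (auto simp: direct_limit_rel_def sym_def)
  show "trans (direct_limit_rel I dir K t)"
  proof (clarsimp simp: trans_def direct_limit_rel_def)
    fix i x j y l z k k'
    assume i: "i \<in> I" "j \<in> I" "l \<in> I" "x \<in> carrier (K i)" "y \<in> carrier (K j)" "z \<in> carrier (K l)"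
      and k: "k \<in> I" "dir i k" "dir j k" "t i k x = t j k y"
      and k': "k' \<in> I" "dir j k'" "dir l k'" "t j k' y = t l k' z"
    obtain m where m: "m \<in> I" "dir k m" "dir k' m"
      using upper_bound k k' by blast
    have "t i m x = t j m y" using rel_later[of i j k m] i k m by auto
    also have "\<dots> = t l m z" using rel_later[of j l k' m] i k' m by auto
    finally show "\<exists>k\<in>I. dir i k \<and> dir l k \<and> t i k x = t l k z"
      using m k k' dir_trans by blast
  qed
qed

lemma germ_eq_iff:
  assumes "i \<in> I" "j \<in> I" "x \<in> carrier (K i)" "y \<in> carrier (K j)"
  shows "germ i x = germ j y \<longleftrightarrow> (\<exists>k\<in>I. dir i k \<and> dir j k \<and> t i k x = t j k y)"
proof -
  have "germ i x = germ j y \<longleftrightarrow> ((i, x), (j, y)) \<in> direct_limit_rel I dir K t"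
    unfolding germ_def using assms by (intro eq_equiv_class_iff[OF equiv_rel]) auto
  then show ?thesis
    using assms by (simp add: direct_limit_rel_def)
qed

lemma germ_t:
  assumes "i \<in> I" "j \<in> I" "dir i j" "x \<in> carrier (K i)"
  shows "germ j (t i j x) = germ i x"
proof -
  obtain k where "k \<in> I" "dir j k" using upper_bound assms by blast
  then show ?thesis
    using assms by (subst germ_eq_iff) (auto simp: t_closed t_comp intro: dir_trans)
qed

lemma carrier_lim: "carrier limit = {germ i x |i x. i \<in> I \<and> x \<in> carrier (K i)}"
  by (auto simp: direct_limit_def germ_def quotient_def)

lemma germ_carrier: "i \<in> I \<Longrightarrow> x \<in> carrier (K i) \<Longrightarrow> germ i x \<in> carrier limit"
  by (auto simp: carrier_lim)

lemma germ_mem: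
  assumes "i \<in> I" "x \<in> carrier (K i)" "(j, y) \<in> germ i x"
  shows "j \<in> I" "y \<in> carrier (K j)" "germ j y = germ i x"
proof -
  have r: "((i, x), (j, y)) \<in> direct_limit_rel I dir K t"
    using assms by (simp add: germ_def)
  then show "j \<in> I" "y \<in> carrier (K j)" by (auto simp: direct_limit_rel_def)
  show "germ j y = germ i x"
    unfolding germ_def using equiv_class_eq[OF equiv_rel r] by simp
qed

lemma germ_self: "i \<in> I \<Longrightarrow> x \<in> carrier (K i) \<Longrightarrow> (i, x) \<in> germ i x"
  using equiv_class_self[OF equiv_rel, of "(i,x)"] by (simp add: germ_def)

text \<open>Finitely many elements of the limit have representatives over a common index, so that
  identities in the limit reduce to identities in a single group.\<close>

lemma common_index:
  assumes "P \<in> carrier limit" "Q \<in> carrier limit" "R \<in> carrier limit"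
  obtains i x y z where "i \<in> I" "x \<in> carrier (K i)" "y \<in> carrier (K i)" "z \<in> carrier (K i)"
    "P = germ i x" "Q = germ i y" "R = germ i z"
proof -
  obtain i x j y k z where *: "i \<in> I" "x \<in> carrier (K i)" "P = germ i x"
    "j \<in> I" "y \<in> carrier (K j)" "Q = germ j y" "k \<in> I" "z \<in> carrier (K k)" "R = germ k z"
    using assms by (auto simp: carrier_lim)
  obtain l where l: "l \<in> I" "dir i l" "dir j l" using upper_bound * by blast
  obtain m where m: "m \<in> I" "dir l m" "dir k m" using upper_bound * l by blast
  have d: "dir i m" "dir j m" using l m dir_trans by blast+
  show thesis
    using * m d by (intro that[of m "t i m x" "t j m y" "t k m z"]) (auto simp: germ_t t_closed)
qed

text \<open>The product set in the definition of the limit is one class because the product of two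
  representatives over an upper bound does not depend on the choices.\<close>

lemma germ_mult:
  assumes "i \<in> I" "x \<in> carrier (K i)" "y \<in> carrier (K i)"
  shows "germ i x \<otimes>\<^bsub>limit\<^esub> germ i y = germ i (x \<otimes>\<^bsub>K i\<^esub> y)"
proof -
  interpret Ki: group "K i" using group assms by blast
  have *: "germ m (t j m u \<otimes>\<^bsub>K m\<^esub> t k m v) = germ i (x \<otimes>\<^bsub>K i\<^esub> y)"
    if ju: "(j, u) \<in> germ i x" and kv: "(k, v) \<in> germ i y" and m: "m \<in> I" "dir j m" "dir k m"
    for j u k v m
  proof -
    note j = germ_mem[OF assms(1,2) ju] and k = germ_mem[OF assms(1,3) kv]
    obtain p where p: "p \<in> I" "dir j p" "dir i p" "t j p u = t i p x"
      using germ_eq_iff assms j by metis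
    obtain q where q: "q \<in> I" "dir k q" "dir i q" "t k q v = t i q y"
      using germ_eq_iff assms k by metis
    obtain r where r: "r \<in> I" "dir p r" "dir q r" using upper_bound p q by blast
    obtain s where s: "s \<in> I" "dir r s" "dir m s" using upper_bound r m by blast
    have d: "dir p s" "dir q s" "dir i s" using r s p dir_trans by blast+
    have u: "t j s u = t i s x" using rel_later[of j i p s] j(1,2) assms p s d by auto
    have v: "t k s v = t i s y" using rel_later[of k i q s] k(1,2) assms q s d by auto
    interpret ms: group_hom "K m" "K s" "t m s" using t_group_hom m s by blast
    interpret iss: group_hom "K i" "K s" "t i s" using t_group_hom assms s d by blast
    have "germ m (t j m u \<otimes>\<^bsub>K m\<^esub> t k m v) = germ s (t m s (t j m u \<otimes>\<^bsub>K m\<^esub> t k m v))"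
      using j(1,2) k(1,2) m s by (intro germ_t[symmetric] ms.G.m_closed t_closed)
    also have "t m s (t j m u \<otimes>\<^bsub>K m\<^esub> t k m v) = t i s (x \<otimes>\<^bsub>K i\<^esub> y)"
      using j(1,2) k(1,2) m s u v assms by (simp add: t_closed t_comp)
    also have "germ s \<dots> = germ i (x \<otimes>\<^bsub>K i\<^esub> y)"
      using assms s d germ_t[of i s "x \<otimes>\<^bsub>K i\<^esub> y"] by simp
    finally show ?thesis .
  qed
  have "germ i x \<otimes>\<^bsub>limit\<^esub> germ i y =
      {w. \<exists>(j, u)\<in>germ i x. \<exists>(k, v)\<in>germ i y. \<exists>m\<in>I. dir j m \<and> dir k m \<and>
            w \<in> germ m (t j m u \<otimes>\<^bsub>K m\<^esub> t k m v)}"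
    by (simp add: direct_limit_def germ_def)
  also have "\<dots> = germ i (x \<otimes>\<^bsub>K i\<^esub> y)"
  proof (intro equalityI subsetI)
    fix w
    assume w: "w \<in> germ i (x \<otimes>\<^bsub>K i\<^esub> y)"
    obtain m where m: "m \<in> I" "dir i m" using upper_bound assms by blast
    have "w \<in> germ m (t i m x \<otimes>\<^bsub>K m\<^esub> t i m y)"
      using *[of i x i y m] w m assms germ_self by simp
    then show "w \<in> {w. \<exists>(j, u)\<in>germ i x. \<exists>(k, v)\<in>germ i y. \<exists>m\<in>I. dir j m \<and> dir k m \<and>
            w \<in> germ m (t j m u \<otimes>\<^bsub>K m\<^esub> t k m v)}"
      using m germ_self[OF assms(1,2)] germ_self[OF assms(1,3)] by blast
  qed (use * in blast)
  finally show ?thesis .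
qed

lemma germ_one:
  assumes "i \<in> I"
  shows "\<one>\<^bsub>limit\<^esub> = germ i \<one>\<^bsub>K i\<^esub>"
proof -
  have *: "germ j \<one>\<^bsub>K j\<^esub> = germ i \<one>\<^bsub>K i\<^esub>" if j: "j \<in> I" for j
  proof -
    obtain k where k: "k \<in> I" "dir i k" "dir j k" using upper_bound assms j by blast
    interpret ik: group_hom "K i" "K k" "t i k" using t_group_hom assms k by blast
    interpret jk: group_hom "K j" "K k" "t j k" using t_group_hom j k by blast
    show ?thesis using assms j k by (subst germ_eq_iff) auto
  qed
  have "\<one>\<^bsub>limit\<^esub> = {w. \<exists>j\<in>I. w \<in> germ j \<one>\<^bsub>K j\<^esub>}"
    by (simp add: direct_limit_def germ_def)
  also have "\<dots> = germ i \<one>\<^bsub>K i\<^esub>" using * assms by blast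
  finally show ?thesis .
qed

lemma group_lim: "group limit"
proof (rule groupI)
  obtain o' where o': "o' \<in> I" using nonempty by blast
  then interpret Ko: group "K o'" by (rule group)
  show one: "\<one>\<^bsub>limit\<^esub> \<in> carrier limit"
    using o' by (simp add: germ_one germ_carrier)
  fix P assume P: "P \<in> carrier limit"
  show "\<one>\<^bsub>limit\<^esub> \<otimes>\<^bsub>limit\<^esub> P = P" "\<exists>Q\<in>carrier limit. Q \<otimes>\<^bsub>limit\<^esub> P = \<one>\<^bsub>limit\<^esub>"
  proof -
    obtain i x where i: "i \<in> I" "x \<in> carrier (K i)" and [simp]: "P = germ i x"
      using P by (auto simp: carrier_lim)
    interpret Ki: group "K i" using i by (simp add: group)
    show "\<one>\<^bsub>limit\<^esub> \<otimes>\<^bsub>limit\<^esub> P = P"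
      using i by (simp add: germ_one[OF i(1)] germ_mult)
    have "germ i (inv\<^bsub>K i\<^esub> x) \<otimes>\<^bsub>limit\<^esub> P = \<one>\<^bsub>limit\<^esub>"
      using i by (simp add: germ_one[OF i(1)] germ_mult)
    then show "\<exists>Q\<in>carrier limit. Q \<otimes>\<^bsub>limit\<^esub> P = \<one>\<^bsub>limit\<^esub>"
      using i Ki.inv_closed germ_carrier by blast
  qed
  fix Q assume Q: "Q \<in> carrier limit"
  show "P \<otimes>\<^bsub>limit\<^esub> Q \<in> carrier limit"
  proof (rule common_index[OF P Q one])
    fix i x y
    assume i: "i \<in> I" "x \<in> carrier (K i)" "y \<in> carrier (K i)" "P = germ i x" "Q = germ i y"
    interpret Ki: group "K i" using i by (simp add: group)
    show ?thesis using i by (simp add: germ_mult germ_carrier)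
  qed
  fix R assume R: "R \<in> carrier limit"
  show "P \<otimes>\<^bsub>limit\<^esub> Q \<otimes>\<^bsub>limit\<^esub> R = P \<otimes>\<^bsub>limit\<^esub> (Q \<otimes>\<^bsub>limit\<^esub> R)"
  proof (rule common_index[OF P Q R])
    fix i x y z
    assume i: "i \<in> I" "x \<in> carrier (K i)" "y \<in> carrier (K i)" "z \<in> carrier (K i)"
      "P = germ i x" "Q = germ i y" "R = germ i z"
    interpret Ki: group "K i" using i by (simp add: group)
    show ?thesis using i by (simp add: germ_mult Ki.m_assoc)
  qed
qed

end

locale directed_system_map = A: directed_system I dir K t + B: directed_system I dir L u
  for I :: "'i set" and dir :: "'i \<Rightarrow> 'i \<Rightarrow> bool" and K :: "'i \<Rightarrow> 'a monoid" and t
    and L :: "'i \<Rightarrow> 'b monoid" and u +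
  fixes h :: "'i \<Rightarrow> 'a \<Rightarrow> 'b"
  assumes h_hom: "i \<in> I \<Longrightarrow> h i \<in> hom (K i) (L i)"
    and h_natural: "i \<in> I \<Longrightarrow> j \<in> I \<Longrightarrow> dir i j \<Longrightarrow> x \<in> carrier (K i)
      \<Longrightarrow> h j (t i j x) = u i j (h i x)"
begin

abbreviation "lim_map \<equiv> direct_limit_map I dir L u h"

lemma h_closed: "i \<in> I \<Longrightarrow> x \<in> carrier (K i) \<Longrightarrow> h i x \<in> carrier (L i)"
  using h_hom hom_in_carrier by metis

lemma lim_map_germ:
  assumes "i \<in> I" "x \<in> carrier (K i)"
  shows "lim_map (A.germ i x) = B.germ i (h i x)"
proof -
  have *: "B.germ j (h j y) = B.germ i (h i x)" if jy: "(j, y) \<in> A.germ i x" for j y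
  proof -
    note j = A.germ_mem[OF assms jy]
    obtain k where k: "k \<in> I" "dir j k" "dir i k" "t j k y = t i k x"
      using A.germ_eq_iff assms j by metis
    have "u j k (h j y) = u i k (h i x)"
      using h_natural[OF j(1) k(1) k(2) j(2)] h_natural[OF assms(1) k(1) k(3) assms(2)] k(4) by simp
    then show ?thesis
      using k j(1,2) assms h_closed by (subst B.germ_eq_iff) auto
  qed
  have "lim_map (A.germ i x) = {w. \<exists>(j, y)\<in>A.germ i x. w \<in> B.germ j (h j y)}"
    by (simp add: direct_limit_map_def B.germ_def)
  also have "\<dots> = B.germ i (h i x)"
    using * A.germ_self[OF assms] by blast
  finally show ?thesis .
qed

lemma group_hom_lim_map: "group_hom A.limit B.limit lim_map"
  unfolding group_hom_def group_hom_axioms_def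
proof (intro conjI A.group_lim B.group_lim homI)
  fix P assume P: "P \<in> carrier A.limit"
  then show "lim_map P \<in> carrier B.limit"
    by (auto simp: A.carrier_lim lim_map_germ intro!: B.germ_carrier h_closed)
  fix Q assume Q: "Q \<in> carrier A.limit"
  show "lim_map (P \<otimes>\<^bsub>A.limit\<^esub> Q) = lim_map P \<otimes>\<^bsub>B.limit\<^esub> lim_map Q"
  proof (rule A.common_index[OF P Q Q])
    fix i x y
    assume i: "i \<in> I" "x \<in> carrier (K i)" "y \<in> carrier (K i)" "P = A.germ i x" "Q = A.germ i y"
    interpret Ki: group "K i" using i by (simp add: A.group)
    show ?thesis
      using i hom_mult[OF h_hom[OF i(1)]] by (simp add: A.germ_mult B.germ_mult lim_map_germ h_closed)
  qed
qed

end

text \<open>Direct limits are exact: if \<open>g y\<close> vanishes in the limit, then it already vanishes at a later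
  index \<open>k\<close>, where exactness yields a preimage of the image of \<open>y\<close>, which represents the same
  element of the limit.\<close>

lemma exact_at_direct_limit:
  assumes "directed_system_map I dir K t L u f" and "directed_system_map I dir L u M v g"
    and exact: "\<And>i. i \<in> I \<Longrightarrow> f i ` carrier (K i) = kernel (L i) (M i) (g i)"
  shows "exact_at (direct_limit I dir K t) (direct_limit_map I dir L u f) (direct_limit I dir L u)
    (direct_limit_map I dir M v g) (direct_limit I dir M v)"
proof -
  interpret F: directed_system_map I dir K t L u f by fact
  interpret G: directed_system_map I dir L u M v g by fact
  have "F.lim_map ` carrier F.A.limit = kernel F.B.limit G.B.limit G.lim_map"
  proof (intro equalityI subsetI)
    fix P assume "P \<in> F.lim_map ` carrier F.A.limit"
    then obtain i x where i: "i \<in> I" "x \<in> carrier (K i)" and P: "P = F.B.germ i (f i x)"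
      by (auto simp: F.A.carrier_lim F.lim_map_germ)
    have "g i (f i x) = \<one>\<^bsub>M i\<^esub>"
      using exact[OF i(1)] i by (auto simp: kernel_def)
    then show "P \<in> kernel F.B.limit G.B.limit G.lim_map"
      using i F.h_closed unfolding kernel_def P
      by (simp add: G.lim_map_germ G.B.germ_one F.B.germ_carrier)
  next
    fix P assume "P \<in> kernel F.B.limit G.B.limit G.lim_map"
    then obtain i y where i: "i \<in> I" "y \<in> carrier (L i)" and P: "P = F.B.germ i y"
      and "G.lim_map P = \<one>\<^bsub>G.B.limit\<^esub>"
      by (auto simp: kernel_def F.B.carrier_lim)
    then have eq: "G.B.germ i (g i y) = G.B.germ i \<one>\<^bsub>M i\<^esub>"
      by (simp add: G.lim_map_germ G.B.germ_one)
    interpret Mi: group "M i" using i by (simp add: G.B.group)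
    obtain k where k: "k \<in> I" "dir i k" "v i k (g i y) = v i k \<one>\<^bsub>M i\<^esub>"
      using eq i G.B.germ_eq_iff[of i i "g i y" "\<one>\<^bsub>M i\<^esub>"] G.h_closed by auto
    interpret ik: group_hom "M i" "M k" "v i k" using i k G.B.t_group_hom by blast
    have "g k (u i k y) = \<one>\<^bsub>M k\<^esub>"
      using G.h_natural[of i k y] i k by simp
    then have "u i k y \<in> kernel (L k) (M k) (g k)"
      using i k by (simp add: kernel_def F.B.t_closed)
    then obtain x where x: "x \<in> carrier (K k)" "u i k y = f k x"
      using exact[OF k(1)] by blast
    have "P = F.lim_map (F.A.germ k x)"
      using x i k P F.B.germ_t[of i k y] by (simp add: F.lim_map_germ)
    then show "P \<in> F.lim_map ` carrier F.A.limit"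
      using x k F.A.germ_carrier by blast
  qed
  then show ?thesis
    unfolding exact_at_def using F.group_hom_lim_map G.group_hom_lim_map by blast
qed


section \<open>Cosets in commutative groups\<close>

context comm_group
begin

lemma mem_r_coset_iff: "y \<in> N #> x \<longleftrightarrow> (\<exists>b\<in>N. y = b \<otimes> x)"
  by (auto simp: r_coset_def)

lemma r_coset_eq_iff:
  assumes "subgroup N G" "x \<in> carrier G" "y \<in> carrier G"
  shows "N #> x = N #> y \<longleftrightarrow> (\<exists>b\<in>N. x = b \<otimes> y)"
  using assms by (metis mem_r_coset_iff rcos_self repr_independence)

lemma r_coset_eq_self_iff:
  assumes "subgroup N G" "x \<in> carrier G"
  shows "N #> x = N \<longleftrightarrow> x \<in> N"
  using assms by (metis coset_join2 rcos_self)

lemma rcos_mult: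
  assumes "subgroup N G" "x \<in> carrier G" "y \<in> carrier G"
  shows "(N #> x) <#> (N #> y) = N #> (x \<otimes> y)"
  using assms by (intro normal.rcos_sum subgroup_imp_normal)

end

text \<open>All members \<open>z\<close> of the coset contribute the same coset to the union defining \<open>coset_map\<close>,
  because \<open>h\<close> maps \<open>H\<close> into \<open>N\<close>. This computes boundaries of quotient complexes as well as induced
  maps in cohomology.\<close>

lemma coset_map_r_coset:
  assumes h: "h \<in> hom K' K" and "comm_group K'" and "comm_group K"
    and H: "subgroup H K'" and N: "subgroup N K" and hH: "h ` H \<subseteq> N" and x: "x \<in> carrier K'"
  shows "coset_map K N h (H #>\<^bsub>K'\<^esub> x) = N #>\<^bsub>K\<^esub> h x"
proof -
  interpret K': comm_group K' by fact
  interpret K: comm_group K by fact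
  interpret h: group_hom K' K h using h by unfold_locales
  have "N #>\<^bsub>K\<^esub> h z = N #>\<^bsub>K\<^esub> h x" if "z \<in> H #>\<^bsub>K'\<^esub> x" for z
  proof -
    from that obtain b where b: "b \<in> H" "z = b \<otimes>\<^bsub>K'\<^esub> x" by (auto simp: K'.mem_r_coset_iff)
    have "b \<in> carrier K'" using b H subgroup.mem_carrier by fast
    then show ?thesis using b x N hH by (subst K.r_coset_eq_iff) auto
  qed
  moreover have "x \<in> H #>\<^bsub>K'\<^esub> x" using K'.rcos_self x H by blast
  ultimately show ?thesis unfolding coset_map_def by blast
qed

lemma coset_map_hom:
  assumes h: "h \<in> hom K' K" and "comm_group K'" and "comm_group K"
    and H: "subgroup H K'" and N: "subgroup N K" and hH: "h ` H \<subseteq> N"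
  shows "coset_map K N h \<in> hom (K' Mod H) (K Mod N)"
proof -
  interpret K': comm_group K' by fact
  interpret K: comm_group K by fact
  interpret h: group_hom K' K h using h by unfold_locales
  note eq = coset_map_r_coset[OF assms]
  show ?thesis
  proof (rule homI)
    fix c assume "c \<in> carrier (K' Mod H)"
    then obtain x where x: "x \<in> carrier K'" "c = H #>\<^bsub>K'\<^esub> x" by (auto simp: carrier_FactGroup)
    then show "coset_map K N h c \<in> carrier (K Mod N)"
      by (simp add: eq carrier_FactGroup)
    fix c' assume "c' \<in> carrier (K' Mod H)"
    then obtain x' where x': "x' \<in> carrier K'" "c' = H #>\<^bsub>K'\<^esub> x'" by (auto simp: carrier_FactGroup)
    show "coset_map K N h (c \<otimes>\<^bsub>K' Mod H\<^esub> c') =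
        coset_map K N h c \<otimes>\<^bsub>K Mod N\<^esub> coset_map K N h c'"
      using x x' by (simp add: K'.rcos_mult[OF H] K.rcos_mult[OF N] eq)
  qed
qed


section \<open>Cochain complexes and their long exact sequence\<close>

locale cochain_complex =
  fixes K :: "int \<Rightarrow> 'a monoid" and \<delta> :: "int \<Rightarrow> 'a \<Rightarrow> 'a"
  assumes comm_group: "comm_group (K n)"
    and \<delta>_hom: "\<delta> n \<in> hom (K n) (K (n + 1))"
    and \<delta>_\<delta>: "x \<in> carrier (K n) \<Longrightarrow> \<delta> (n + 1) (\<delta> n x) = \<one>\<^bsub>K (n + 1 + 1)\<^esub>"
begin

sublocale K: comm_group "K n" for n
  by (rule comm_group)

sublocale \<delta>: group_hom "K n" "K (n + 1)" "\<delta> n" for n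
  using \<delta>_hom by unfold_locales

definition Z where "Z n = kernel (K n) (K (n + 1)) (\<delta> n)"
definition B where "B n = \<delta> (n - 1) ` carrier (K (n - 1))"
definition H where "H n = (K n)\<lparr>carrier := Z n\<rparr> Mod B n"
definition cls where "cls n x = B n #>\<^bsub>K n\<^esub> x"

lemma mem_Z_iff: "x \<in> Z n \<longleftrightarrow> x \<in> carrier (K n) \<and> \<delta> n x = \<one>\<^bsub>K (n + 1)\<^esub>"
  by (simp add: Z_def kernel_def)

lemma Z_carrier: "x \<in> Z n \<Longrightarrow> x \<in> carrier (K n)"
  by (simp add: mem_Z_iff)

lemma \<delta>_closed' [simp]: "x \<in> carrier (K (n - 1)) \<Longrightarrow> \<delta> (n - 1) x \<in> carrier (K n)"
  using \<delta>.hom_closed[of x "n - 1"] by simp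

lemma subgroup_Z: "subgroup (Z n) (K n)"
  unfolding Z_def by (rule \<delta>.subgroup_kernel)

lemma subgroup_B: "subgroup (B n) (K n)"
  using \<delta>.img_is_subgroup[of "n - 1"] by (simp add: B_def)

lemma B_subset_Z: "B n \<subseteq> Z n"
  using \<delta>_\<delta>[of _ "n - 1"] by (auto simp: B_def mem_Z_iff algebra_simps)

lemma comm_group_Z: "comm_group ((K n)\<lparr>carrier := Z n\<rparr>)"
proof (rule group.group_comm_groupI)
  show "Group.group ((K n)\<lparr>carrier := Z n\<rparr>)"
    using K.subgroup_imp_group subgroup_Z by blast
qed (simp add: K.m_comm Z_carrier)

lemma subgroup_B_Z: "subgroup (B n) ((K n)\<lparr>carrier := Z n\<rparr>)"
  using K.subgroup_incl subgroup_B subgroup_Z B_subset_Z by blast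

lemma comm_group_H: "comm_group (H n)"
  unfolding H_def by (rule comm_group.abelian_FactGroup[OF comm_group_Z subgroup_B_Z])

sublocale H: comm_group "H n" for n
  by (rule comm_group_H)

lemma cls_alt: "cls n x = B n #>\<^bsub>(K n)\<lparr>carrier := Z n\<rparr>\<^esub> x"
  by (simp add: cls_def r_coset_def)

lemma carrier_H: "carrier (H n) = cls n ` Z n"
  by (simp add: H_def carrier_FactGroup cls_alt)

lemma cls_closed: "x \<in> Z n \<Longrightarrow> cls n x \<in> carrier (H n)"
  by (simp add: carrier_H)

lemma cls_mult:
  assumes "x \<in> Z n" "y \<in> Z n"
  shows "cls n x \<otimes>\<^bsub>H n\<^esub> cls n y = cls n (x \<otimes>\<^bsub>K n\<^esub> y)"
  using comm_group.rcos_mult[OF comm_group_Z subgroup_B_Z, of x n y] assms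
  by (simp add: H_def cls_alt)

lemma mem_cls_iff: "y \<in> cls n x \<longleftrightarrow> (\<exists>b\<in>carrier (K (n - 1)). y = \<delta> (n - 1) b \<otimes>\<^bsub>K n\<^esub> x)"
  by (auto simp: cls_def K.mem_r_coset_iff B_def)

lemma cls_eq_iff:
  assumes "x \<in> Z n" "y \<in> Z n"
  shows "cls n x = cls n y \<longleftrightarrow> (\<exists>b\<in>carrier (K (n - 1)). x = \<delta> (n - 1) b \<otimes>\<^bsub>K n\<^esub> y)"
  using K.r_coset_eq_iff[OF subgroup_B] assms by (auto simp: cls_def B_def Z_carrier)

lemma cls_eq_one_iff:
  assumes "x \<in> Z n"
  shows "cls n x = \<one>\<^bsub>H n\<^esub> \<longleftrightarrow> (\<exists>b\<in>carrier (K (n - 1)). x = \<delta> (n - 1) b)"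
  using K.r_coset_eq_self_iff[OF subgroup_B] assms
  by (auto simp: cls_def H_def Z_carrier B_def)

lemma cls_one: "cls n \<one>\<^bsub>K n\<^esub> = \<one>\<^bsub>H n\<^esub>"
  using subgroup_B by (simp add: cls_def H_def K.coset_join2 subgroup.one_closed)

lemma mem_cls_Z: "x \<in> Z n \<Longrightarrow> y \<in> cls n x \<Longrightarrow> y \<in> Z n"
  using B_subset_Z[of n] subgroup.m_closed[OF subgroup_Z, of _ n x]
  by (auto simp: cls_def K.mem_r_coset_iff)

lemma cls_self: "x \<in> Z n \<Longrightarrow> x \<in> cls n x"
  using K.rcos_self subgroup_B Z_carrier by (simp add: cls_def)

end

locale cochain_morphism = K: cochain_complex K \<delta> + L: cochain_complex L \<epsilon>
  for K :: "int \<Rightarrow> 'a monoid" and \<delta> and L :: "int \<Rightarrow> 'b monoid" and \<epsilon> +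
  fixes f :: "int \<Rightarrow> 'a \<Rightarrow> 'b"
  assumes f_hom: "f n \<in> hom (K n) (L n)"
    and f_\<delta>: "x \<in> carrier (K n) \<Longrightarrow> f (n + 1) (\<delta> n x) = \<epsilon> n (f n x)"
begin

sublocale f: group_hom "K n" "L n" "f n" for n
  using f_hom by unfold_locales

abbreviation "induced n \<equiv> coset_map (L n) (L.B n) (f n)"

lemma f_\<delta>': "x \<in> carrier (K (n - 1)) \<Longrightarrow> f n (\<delta> (n - 1) x) = \<epsilon> (n - 1) (f (n - 1) x)"
  using f_\<delta>[of x "n - 1"] by simp

lemma f_Z: "x \<in> K.Z n \<Longrightarrow> f n x \<in> L.Z n"
  using f_\<delta>[of x n] by (simp add: K.mem_Z_iff L.mem_Z_iff)

lemma f_B: "f n ` K.B n \<subseteq> L.B n"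
  using f_\<delta>' by (auto simp: K.B_def L.B_def)

lemma induced_cls: "x \<in> K.Z n \<Longrightarrow> induced n (K.cls n x) = L.cls n (f n x)"
  unfolding K.cls_def L.cls_def
  by (intro coset_map_r_coset f_hom K.comm_group L.comm_group K.subgroup_B L.subgroup_B f_B K.Z_carrier)

lemma induced_hom: "induced n \<in> hom (K.H n) (L.H n)"
  by (rule homI)
    (auto simp: K.carrier_H L.carrier_H K.cls_mult L.cls_mult induced_cls f_Z K.Z_carrier
      subgroup.m_closed[OF K.subgroup_Z])

end

lemma induced_comp:
  assumes "cochain_morphism K \<delta> L \<epsilon> f" and "cochain_morphism L \<epsilon> M \<zeta> g"
    and "cochain_morphism K \<delta> M \<zeta> h"
    and gf: "\<And>x. x \<in> carrier (K n) \<Longrightarrow> g n (f n x) = h n x"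
    and c: "c \<in> carrier (cochain_complex.H K \<delta> n)"
  shows "coset_map (M n) (cochain_complex.B M \<zeta> n) (g n)
      (coset_map (L n) (cochain_complex.B L \<epsilon> n) (f n) c) =
    coset_map (M n) (cochain_complex.B M \<zeta> n) (h n) c"
proof -
  interpret f: cochain_morphism K \<delta> L \<epsilon> f by fact
  interpret g: cochain_morphism L \<epsilon> M \<zeta> g by fact
  interpret h: cochain_morphism K \<delta> M \<zeta> h by fact
  show ?thesis
    using c by (auto simp: f.K.carrier_H f.induced_cls g.induced_cls h.induced_cls f.f_Z gf f.K.Z_carrier)
qed

text \<open>A short exact sequence \<open>0 \<rightarrow> K \<rightarrow> L \<rightarrow> M \<rightarrow> 0\<close> of cochain complexes.\<close>

locale cochain_ses =
  J: cochain_morphism K \<delta> L \<epsilon> j + P: cochain_morphism L \<epsilon> M \<zeta> p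
  for K :: "int \<Rightarrow> 'a monoid" and \<delta> and L :: "int \<Rightarrow> 'b monoid" and \<epsilon>
    and M :: "int \<Rightarrow> 'c monoid" and \<zeta> and j and p +
  assumes j_inj: "inj_on (j n) (carrier (K n))"
    and j_image: "j n ` carrier (K n) = kernel (L n) (M n) (p n)"
    and p_surj: "p n ` carrier (L n) = carrier (M n)"
begin

definition connecting where
  "connecting n c = {\<psi> \<in> J.K.Z (n + 1). \<exists>\<phi>\<in>c. \<exists>\<eta>\<in>carrier (L n). p n \<eta> = \<phi> \<and> \<epsilon> n \<eta> = j (n + 1) \<psi>}"

text \<open>\<open>\<eta>\<close> and \<open>\<psi>\<close> witness that the connecting homomorphism takes the class of \<open>\<phi>\<close> to the class
  of \<open>\<psi>\<close>.\<close>

definition snake where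
  "snake n \<phi> \<eta> \<psi> \<longleftrightarrow> \<phi> \<in> P.L.Z n \<and> \<eta> \<in> carrier (L n) \<and> \<psi> \<in> carrier (K (n + 1)) \<and>
     p n \<eta> = \<phi> \<and> \<epsilon> n \<eta> = j (n + 1) \<psi>"

lemma p_j: "x \<in> carrier (K n) \<Longrightarrow> p n (j n x) = \<one>\<^bsub>M n\<^esub>"
  using j_image[of n] by (auto simp: kernel_def)

lemma kernel_p: "x \<in> carrier (L n) \<Longrightarrow> p n x = \<one>\<^bsub>M n\<^esub> \<Longrightarrow> \<exists>y\<in>carrier (K n). x = j n y"
  using j_image[of n] by (auto simp: kernel_def)

lemma p_lift: "x \<in> carrier (M n) \<Longrightarrow> \<exists>y\<in>carrier (L n). x = p n y"
  using p_surj[of n] by auto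

lemma j_eq: "x \<in> carrier (K n) \<Longrightarrow> y \<in> carrier (K n) \<Longrightarrow> j n x = j n y \<longleftrightarrow> x = y"
  using j_inj by (auto dest: inj_onD)

lemma j_Z_iff:
  assumes "x \<in> carrier (K n)"
  shows "j n x \<in> J.L.Z n \<longleftrightarrow> x \<in> J.K.Z n"
  using assms J.f_\<delta>[of x n] j_eq[of "\<delta> n x" "n + 1" "\<one>\<^bsub>K (n + 1)\<^esub>"]
  by (simp add: J.K.mem_Z_iff J.L.mem_Z_iff)

lemma snake_Z:
  assumes "snake n \<phi> \<eta> \<psi>"
  shows "\<phi> \<in> P.L.Z n" "\<psi> \<in> J.K.Z (n + 1)"
proof -
  show "\<phi> \<in> P.L.Z n" using assms by (simp add: snake_def)
  have "j (n + 1) \<psi> \<in> J.L.Z (n + 1)"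
    using assms J.L.\<delta>_\<delta>[of \<eta> n] by (auto simp: snake_def J.L.mem_Z_iff)
  then show "\<psi> \<in> J.K.Z (n + 1)"
    using assms j_Z_iff by (simp add: snake_def)
qed

text \<open>Lift \<open>\<phi>\<close> to some \<open>\<eta>\<close>; as \<open>\<phi>\<close> is a cocycle, \<open>\<epsilon> \<eta>\<close> dies in \<open>M\<close> and therefore comes from \<open>K\<close>.\<close>

lemma snake_exists:
  assumes "\<phi> \<in> P.L.Z n"
  obtains \<eta> \<psi> where "snake n \<phi> \<eta> \<psi>"
proof -
  obtain \<eta> where \<eta>: "\<eta> \<in> carrier (L n)" "\<phi> = p n \<eta>"
    using assms p_lift P.L.Z_carrier by blast
  have "p (n + 1) (\<epsilon> n \<eta>) = \<one>\<^bsub>M (n + 1)\<^esub>"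
    using assms \<eta> P.f_\<delta> by (simp add: P.L.mem_Z_iff)
  then obtain \<psi> where "\<psi> \<in> carrier (K (n + 1))" "\<epsilon> n \<eta> = j (n + 1) \<psi>"
    using kernel_p \<eta> J.L.\<delta>.hom_closed by blast
  then show thesis
    using that \<eta> assms by (auto simp: snake_def)
qed

text \<open>Two choices of \<open>\<eta>\<close> for cohomologous \<open>\<phi>\<close> differ by a coboundary \<open>\<epsilon> b\<close> and an element \<open>j k\<close>;
  the former does not change \<open>\<epsilon> \<eta>\<close>, and the latter changes \<open>\<psi>\<close> by the coboundary of \<open>k\<close>. Conversely
  every \<open>\<psi>'\<close> in the class of \<open>\<psi>\<close> arises from replacing \<open>\<eta>\<close> by a suitable \<open>j k \<otimes> \<eta>\<close>.\<close>

lemma connecting_cls: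
  assumes s: "snake n \<phi> \<eta> \<psi>"
  shows "connecting n (P.L.cls n \<phi>) = J.K.cls (n + 1) \<psi>"
proof (intro equalityI subsetI)
  have s': "\<eta> \<in> carrier (L n)" "\<psi> \<in> carrier (K (n + 1))" "p n \<eta> = \<phi>" "\<epsilon> n \<eta> = j (n + 1) \<psi>"
    "\<phi> \<in> carrier (M n)"
    using s P.L.Z_carrier by (auto simp: snake_def)
  {
    fix \<psi>' assume "\<psi>' \<in> J.K.cls (n + 1) \<psi>"
    then obtain k where k: "k \<in> carrier (K n)" "\<psi>' = \<delta> n k \<otimes>\<^bsub>K (n + 1)\<^esub> \<psi>"
      by (auto simp: J.K.mem_cls_iff)
    let ?\<eta> = "j n k \<otimes>\<^bsub>L n\<^esub> \<eta>"
    have "p n ?\<eta> = \<phi>" "\<epsilon> n ?\<eta> = j (n + 1) \<psi>'"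
      using k s' by (simp_all add: p_j J.f_\<delta>)
    moreover have "\<psi>' \<in> J.K.Z (n + 1)"
      using J.K.mem_cls_Z snake_Z(2)[OF s] \<open>\<psi>' \<in> _\<close> by blast
    ultimately show "\<psi>' \<in> connecting n (P.L.cls n \<phi>)"
      using P.L.cls_self[OF snake_Z(1)[OF s]] k s' unfolding connecting_def
      by (auto intro!: bexI[of _ ?\<eta>])
  next
    fix \<psi>' assume "\<psi>' \<in> connecting n (P.L.cls n \<phi>)"
    then obtain \<eta>' where \<psi>': "\<psi>' \<in> J.K.Z (n + 1)" and \<eta>': "\<eta>' \<in> carrier (L n)"
      "p n \<eta>' \<in> P.L.cls n \<phi>" "\<epsilon> n \<eta>' = j (n + 1) \<psi>'"
      by (auto simp: connecting_def)
    then obtain b' where b': "b' \<in> carrier (M (n - 1))" "p n \<eta>' = \<zeta> (n - 1) b' \<otimes>\<^bsub>M n\<^esub> \<phi>"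
      by (auto simp: P.L.mem_cls_iff)
    then obtain b where b: "b \<in> carrier (L (n - 1))" "b' = p (n - 1) b"
      using p_lift by blast
    have \<psi>'_carrier: "\<psi>' \<in> carrier (K (n + 1))" using \<psi>' J.K.Z_carrier by blast
    let ?\<theta> = "\<epsilon> (n - 1) b \<otimes>\<^bsub>L n\<^esub> \<eta>"
    have \<theta>: "?\<theta> \<in> carrier (L n)" using b s' by simp
    have "p n ?\<theta> = p n \<eta>'" using b b' s' P.f_\<delta>' by simp
    then have "p n (\<eta>' \<otimes>\<^bsub>L n\<^esub> inv\<^bsub>L n\<^esub> ?\<theta>) = \<one>\<^bsub>M n\<^esub>"
      using \<theta> \<eta>'(1) by (simp del: J.L.K.inv_mult)
    then obtain k where k: "k \<in> carrier (K n)" "\<eta>' \<otimes>\<^bsub>L n\<^esub> inv\<^bsub>L n\<^esub> ?\<theta> = j n k"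
      using kernel_p[of "\<eta>' \<otimes>\<^bsub>L n\<^esub> inv\<^bsub>L n\<^esub> ?\<theta>"] \<theta> \<eta>' by blast
    then have \<eta>'_eq: "\<eta>' = j n k \<otimes>\<^bsub>L n\<^esub> ?\<theta>"
      using \<theta> \<eta>' J.L.K.inv_solve_right' J.f.hom_closed by metis
    have "\<epsilon> n (\<epsilon> (n - 1) b) = \<one>\<^bsub>L (n + 1)\<^esub>"
      using J.L.\<delta>_\<delta>[OF b(1)] by (simp add: algebra_simps)
    then have "\<epsilon> n \<eta>' = \<epsilon> n (j n k) \<otimes>\<^bsub>L (n + 1)\<^esub> \<epsilon> n \<eta>"
      using k b s' \<theta> by (simp add: \<eta>'_eq)
    then have "j (n + 1) \<psi>' = j (n + 1) (\<delta> n k \<otimes>\<^bsub>K (n + 1)\<^esub> \<psi>)"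
      using k s' \<eta>' J.f_\<delta> by simp
    then have "\<psi>' = \<delta> n k \<otimes>\<^bsub>K (n + 1)\<^esub> \<psi>"
      using \<psi>'_carrier k s' by (subst (asm) j_eq) auto
    then show "\<psi>' \<in> J.K.cls (n + 1) \<psi>"
      using k by (auto simp: J.K.mem_cls_iff)
  }
qed

lemma snake_mult:
  assumes "snake n \<phi> \<eta> \<psi>" "snake n \<phi>' \<eta>' \<psi>'"
  shows "snake n (\<phi> \<otimes>\<^bsub>M n\<^esub> \<phi>') (\<eta> \<otimes>\<^bsub>L n\<^esub> \<eta>') (\<psi> \<otimes>\<^bsub>K (n + 1)\<^esub> \<psi>')"
  using assms by (auto simp: snake_def intro: subgroup.m_closed[OF P.L.subgroup_Z])

lemma connecting_hom: "connecting n \<in> hom (P.L.H n) (J.K.H (n + 1))"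
proof (rule homI)
  fix c assume "c \<in> carrier (P.L.H n)"
  then obtain \<phi> where \<phi>: "\<phi> \<in> P.L.Z n" and c: "c = P.L.cls n \<phi>" by (auto simp: P.L.carrier_H)
  obtain \<eta> \<psi> where s: "snake n \<phi> \<eta> \<psi>" using snake_exists \<phi> by blast
  show "connecting n c \<in> carrier (J.K.H (n + 1))"
    using snake_Z[OF s] by (simp add: c connecting_cls[OF s] J.K.cls_closed)
  fix c' assume "c' \<in> carrier (P.L.H n)"
  then obtain \<phi>' where \<phi>': "\<phi>' \<in> P.L.Z n" and c': "c' = P.L.cls n \<phi>'" by (auto simp: P.L.carrier_H)
  obtain \<eta>' \<psi>' where s': "snake n \<phi>' \<eta>' \<psi>'" using snake_exists \<phi>' by blast
  show "connecting n (c \<otimes>\<^bsub>P.L.H n\<^esub> c') = connecting n c \<otimes>\<^bsub>J.K.H (n + 1)\<^esub> connecting n c'"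
    using snake_Z[OF s] snake_Z[OF s']
    by (simp add: c c' connecting_cls[OF s] connecting_cls[OF s']
        connecting_cls[OF snake_mult[OF s s']] P.L.cls_mult J.K.cls_mult)
qed

text \<open>If \<open>p x\<close> is the coboundary of \<open>p b\<close>, then \<open>x\<close> minus the coboundary of \<open>b\<close> is cohomologous to \<open>x\<close>
  and vanishes in \<open>M\<close>, so it is the image of a cocycle of \<open>K\<close>.\<close>

lemma exact_at_L:
  "J.induced n ` carrier (J.K.H n) = kernel (J.L.H n) (P.L.H n) (P.induced n)"
proof (intro equalityI subsetI)
  fix c assume "c \<in> J.induced n ` carrier (J.K.H n)"
  then obtain x where x: "x \<in> J.K.Z n" "c = J.L.cls n (j n x)"
    by (auto simp: J.K.carrier_H J.induced_cls)
  have "p n (j n x) = \<one>\<^bsub>M n\<^esub>"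
    using x p_j J.K.Z_carrier by simp
  then show "c \<in> kernel (J.L.H n) (P.L.H n) (P.induced n)"
    using x J.f_Z[OF x(1)] P.f_Z[OF J.f_Z[OF x(1)]] unfolding kernel_def
    by (auto simp: P.induced_cls J.L.cls_closed P.L.cls_one)
next
  fix c assume "c \<in> kernel (J.L.H n) (P.L.H n) (P.induced n)"
  then obtain x where x: "x \<in> J.L.Z n" and c: "c = J.L.cls n x" "P.L.cls n (p n x) = \<one>\<^bsub>P.L.H n\<^esub>"
    by (auto simp: kernel_def J.L.carrier_H P.induced_cls)
  obtain b where b: "b \<in> carrier (L (n - 1))" "p n x = \<zeta> (n - 1) (p (n - 1) b)"
    using c P.f_Z[OF x] P.L.cls_eq_one_iff p_lift by metis
  have xc: "x \<in> carrier (L n)" using x J.L.Z_carrier by blast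
  let ?y = "\<epsilon> (n - 1) (inv\<^bsub>L (n - 1)\<^esub> b) \<otimes>\<^bsub>L n\<^esub> x"
  have inv: "\<epsilon> (n - 1) (inv\<^bsub>L (n - 1)\<^esub> b) = inv\<^bsub>L n\<^esub> (\<epsilon> (n - 1) b)"
    using J.L.\<delta>.hom_inv[OF b(1)] by simp
  have mem: "?y \<in> J.L.cls n x"
    unfolding J.L.mem_cls_iff using J.L.K.inv_closed[OF b(1)] by blast
  then have y: "?y \<in> J.L.Z n" by (rule J.L.mem_cls_Z[OF x])
  then have y_cls: "J.L.cls n ?y = c"
    using mem c(1) x J.L.cls_eq_iff[of ?y n x] J.L.mem_cls_iff by simp
  have "p n ?y = \<one>\<^bsub>M n\<^esub>"
    using b xc P.f_\<delta>'[OF b(1)] by (simp add: inv P.L.K.l_inv)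
  then obtain k where k: "k \<in> carrier (K n)" "?y = j n k"
    using kernel_p y J.L.Z_carrier by blast
  have "k \<in> J.K.Z n" using j_Z_iff k y by simp
  then show "c \<in> J.induced n ` carrier (J.K.H n)"
    using k y_cls by (auto simp: J.K.carrier_H J.induced_cls image_iff)
qed

text \<open>If \<open>\<psi>\<close> is the coboundary of \<open>k\<close>, then \<open>\<eta>\<close> minus \<open>j k\<close> is a cocycle that still lifts \<open>\<phi>\<close>.\<close>

lemma exact_at_M:
  "P.induced n ` carrier (J.L.H n) = kernel (P.L.H n) (J.K.H (n + 1)) (connecting n)"
proof (intro equalityI subsetI)
  fix c assume "c \<in> P.induced n ` carrier (J.L.H n)"
  then obtain x where x: "x \<in> J.L.Z n" and c: "c = P.L.cls n (p n x)"
    by (auto simp: J.L.carrier_H P.induced_cls)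
  have s: "snake n (p n x) x \<one>\<^bsub>K (n + 1)\<^esub>"
    using x P.f_Z[OF x] by (auto simp: snake_def J.L.mem_Z_iff)
  show "c \<in> kernel (P.L.H n) (J.K.H (n + 1)) (connecting n)"
    using P.f_Z[OF x] by (simp add: kernel_def c P.L.cls_closed connecting_cls[OF s] J.K.cls_one)
next
  fix c assume "c \<in> kernel (P.L.H n) (J.K.H (n + 1)) (connecting n)"
  then obtain \<phi> where \<phi>: "\<phi> \<in> P.L.Z n" and c: "c = P.L.cls n \<phi>" "connecting n c = \<one>\<^bsub>J.K.H (n + 1)\<^esub>"
    by (auto simp: kernel_def P.L.carrier_H)
  obtain \<eta> \<psi> where s: "snake n \<phi> \<eta> \<psi>" using snake_exists \<phi> by blast
  then obtain k where k: "k \<in> carrier (K n)" "\<psi> = \<delta> n k"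
    using c connecting_cls[OF s] J.K.cls_eq_one_iff[OF snake_Z(2)[OF s]] by auto
  have s': "\<eta> \<in> carrier (L n)" "p n \<eta> = \<phi>" "\<epsilon> n \<eta> = j (n + 1) \<psi>" "\<phi> \<in> carrier (M n)"
    using s P.L.Z_carrier by (auto simp: snake_def)
  let ?x = "\<eta> \<otimes>\<^bsub>L n\<^esub> inv\<^bsub>L n\<^esub> (j n k)"
  have "?x \<in> J.L.Z n" "p n ?x = \<phi>"
    using s' k by (simp_all add: J.L.mem_Z_iff J.f_\<delta> p_j)
  then show "c \<in> P.induced n ` carrier (J.L.H n)"
    by (force simp: c J.L.carrier_H P.induced_cls)
qed

text \<open>\<open>j \<psi>\<close> is a coboundary \<open>\<epsilon> \<eta>\<close> precisely if \<open>\<psi>\<close> arises from the lift \<open>\<eta>\<close> of the cocycle \<open>p \<eta>\<close>.\<close>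

lemma exact_at_K:
  "connecting n ` carrier (P.L.H n) = kernel (J.K.H (n + 1)) (J.L.H (n + 1)) (J.induced (n + 1))"
proof (intro equalityI subsetI)
  fix c assume "c \<in> connecting n ` carrier (P.L.H n)"
  then obtain \<phi> where \<phi>: "\<phi> \<in> P.L.Z n" and c: "c = connecting n (P.L.cls n \<phi>)"
    by (auto simp: P.L.carrier_H)
  obtain \<eta> \<psi> where s: "snake n \<phi> \<eta> \<psi>" using snake_exists \<phi> by blast
  have "\<eta> \<in> carrier (L n)" "j (n + 1) \<psi> = \<epsilon> n \<eta>" using s by (auto simp: snake_def)
  then show "c \<in> kernel (J.K.H (n + 1)) (J.L.H (n + 1)) (J.induced (n + 1))"
    using snake_Z(2)[OF s] J.f_Z[OF snake_Z(2)[OF s]]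
    by (auto simp: kernel_def c connecting_cls[OF s] J.K.cls_closed J.induced_cls J.L.cls_eq_one_iff)
next
  fix c assume "c \<in> kernel (J.K.H (n + 1)) (J.L.H (n + 1)) (J.induced (n + 1))"
  then obtain \<psi> where \<psi>: "\<psi> \<in> J.K.Z (n + 1)" and c: "c = J.K.cls (n + 1) \<psi>"
    and "J.L.cls (n + 1) (j (n + 1) \<psi>) = \<one>\<^bsub>J.L.H (n + 1)\<^esub>"
    by (auto simp: kernel_def J.K.carrier_H J.induced_cls)
  then obtain \<eta> where \<eta>: "\<eta> \<in> carrier (L n)" "j (n + 1) \<psi> = \<epsilon> n \<eta>"
    using J.L.cls_eq_one_iff[OF J.f_Z[OF \<psi>]] by auto
  have "\<zeta> n (p n \<eta>) = \<one>\<^bsub>M (n + 1)\<^esub>"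
    using P.f_\<delta>[OF \<eta>(1)] p_j[of \<psi> "n + 1"] \<eta> \<psi> J.K.Z_carrier by metis
  then have "snake n (p n \<eta>) \<eta> \<psi>"
    using \<eta> \<psi> by (auto simp: snake_def P.L.mem_Z_iff J.K.mem_Z_iff)
  then show "c \<in> connecting n ` carrier (P.L.H n)"
    using snake_Z(1) by (metis connecting_cls c P.L.cls_closed image_eqI)
qed

end

text \<open>A morphism of short exact sequences maps the witnesses \<open>(\<phi>, \<eta>, \<psi>)\<close> for one connecting
  homomorphism to witnesses for the other.\<close>

lemma connecting_natural:
  assumes "cochain_ses K \<delta> L \<epsilon> M \<zeta> j p" and "cochain_ses K' \<delta>' L' \<epsilon>' M' \<zeta>' j' p'"
    and "cochain_morphism K \<delta> K' \<delta>' f" and "cochain_morphism L \<epsilon> L' \<epsilon>' g"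
    and "cochain_morphism M \<zeta> M' \<zeta>' h"
    and gj: "\<And>x. x \<in> carrier (K (n + 1)) \<Longrightarrow> g (n + 1) (j (n + 1) x) = j' (n + 1) (f (n + 1) x)"
    and hp: "\<And>x. x \<in> carrier (L n) \<Longrightarrow> h n (p n x) = p' n (g n x)"
    and c: "c \<in> carrier (cochain_complex.H M \<zeta> n)"
  shows "cochain_ses.connecting K' \<delta>' L' \<epsilon>' j' p' n
      (coset_map (M' n) (cochain_complex.B M' \<zeta>' n) (h n) c) =
    coset_map (K' (n + 1)) (cochain_complex.B K' \<delta>' (n + 1)) (f (n + 1))
      (cochain_ses.connecting K \<delta> L \<epsilon> j p n c)"
proof -
  interpret S: cochain_ses K \<delta> L \<epsilon> M \<zeta> j p by fact
  interpret S': cochain_ses K' \<delta>' L' \<epsilon>' M' \<zeta>' j' p' by fact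
  interpret F: cochain_morphism K \<delta> K' \<delta>' f by fact
  interpret G: cochain_morphism L \<epsilon> L' \<epsilon>' g by fact
  interpret E: cochain_morphism M \<zeta> M' \<zeta>' h by fact
  obtain \<phi> where \<phi>: "\<phi> \<in> S.P.L.Z n" "c = S.P.L.cls n \<phi>"
    using c by (auto simp: S.P.L.carrier_H)
  obtain \<eta> \<psi> where s: "S.snake n \<phi> \<eta> \<psi>" using S.snake_exists \<phi>(1) by blast
  have "S'.snake n (h n \<phi>) (g n \<eta>) (f (n + 1) \<psi>)"
    using s E.f_Z[OF \<phi>(1)] unfolding S.snake_def S'.snake_def
    by (auto simp flip: gj hp G.f_\<delta>)
  then show ?thesis
    using \<phi> S.snake_Z[OF s]
    by (simp add: S.connecting_cls[OF s] S'.connecting_cls E.induced_cls F.induced_cls)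
qed


section \<open>Cohomology of a pair of chain complexes\<close>

context
  fixes C :: "'c monoid" and G :: "'g monoid"
  assumes C: "Group.group C" and G: "comm_group G"
begin

interpretation C: Group.group C by (rule C)
interpretation G: comm_group G by (rule G)

lemma comm_group_hom_group: "comm_group (hom_group C G)"
proof (rule comm_groupI)
  fix \<phi> assume \<phi>: "\<phi> \<in> carrier (hom_group C G)"
  let ?\<psi> = "\<lambda>x\<in>carrier C. inv\<^bsub>G\<^esub> \<phi> x"
  have "?\<psi> \<in> carrier (hom_group C G)"
    using \<phi> by (auto simp: hom_group_def hom_def Pi_def G.inv_mult)
  moreover have "?\<psi> \<otimes>\<^bsub>hom_group C G\<^esub> \<phi> = \<one>\<^bsub>hom_group C G\<^esub>"
    using \<phi> by (auto simp: hom_group_def hom_def Pi_def)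
  ultimately show "\<exists>\<psi>\<in>carrier (hom_group C G). \<psi> \<otimes>\<^bsub>hom_group C G\<^esub> \<phi> = \<one>\<^bsub>hom_group C G\<^esub>"
    by blast
next
  fix \<phi> assume "\<phi> \<in> carrier (hom_group C G)"
  then show "\<one>\<^bsub>hom_group C G\<^esub> \<otimes>\<^bsub>hom_group C G\<^esub> \<phi> = \<phi>"
    by (auto simp: hom_group_def hom_def Pi_def intro!: extensionalityI[of _ "carrier C"])
qed (auto simp: hom_group_def hom_def Pi_def G.m_ac)

end

lemma compose_hom_group:
  assumes "Group.group C" and "f \<in> hom C D"
  shows "(\<lambda>\<phi>. compose (carrier C) \<phi> f) \<in> hom (hom_group D G) (hom_group C G)"
proof -
  interpret C: Group.group C by fact
  show ?thesis
    using assms(2) by (auto simp: hom_group_def hom_def Pi_def compose_def)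
qed

locale chain_cpx =
  fixes C :: "'c chain_complex"
  assumes comm_group: "comm_group (chains C n)"
    and bdry_hom: "bdry C n \<in> hom (chains C n) (chains C (n - 1))"
    and bdry_bdry: "x \<in> carrier (chains C n) \<Longrightarrow>
      bdry C (n - 1) (bdry C n x) = \<one>\<^bsub>chains C (n - 1 - 1)\<^esub>"
begin

sublocale C: comm_group "chains C n" for n
  by (rule comm_group)

sublocale bdry: group_hom "chains C n" "chains C (n - 1)" "bdry C n" for n
  using bdry_hom by unfold_locales

lemma bdry_Suc_hom: "bdry C (n + 1) \<in> hom (chains C (n + 1)) (chains C n)"
  using bdry_hom[of "n + 1"] by simp

lemma bdry_Suc_closed: "x \<in> carrier (chains C (n + 1)) \<Longrightarrow> bdry C (n + 1) x \<in> carrier (chains C n)"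
  using bdry_Suc_hom hom_in_carrier by metis

lemma bdry_Suc_bdry_Suc:
  "x \<in> carrier (chains C (n + 1 + 1)) \<Longrightarrow> bdry C (n + 1) (bdry C (n + 1 + 1) x) = \<one>\<^bsub>chains C n\<^esub>"
  using bdry_bdry[of x "n + 1 + 1"] by (simp only: add_diff_cancel_right')

lemma cochain_carrier_iff:
  "\<phi> \<in> carrier (cochains C G n) \<longleftrightarrow> \<phi> \<in> hom (chains C n) G \<and> \<phi> \<in> extensional (carrier (chains C n))"
  by (simp add: cochains_def hom_group_def)

lemma cochain_eqI:
  assumes "\<phi> \<in> carrier (cochains C G n)" "\<psi> \<in> carrier (cochains C G n)"
    and "\<And>x. x \<in> carrier (chains C n) \<Longrightarrow> \<phi> x = \<psi> x"
  shows "\<phi> = \<psi>"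
  using assms by (auto simp: cochain_carrier_iff intro: extensionalityI)

lemma cochain_complex_cochains:
  assumes "comm_group G"
  shows "cochain_complex (cochains C G) (coboundary C)"
proof (rule cochain_complex.intro)
  interpret G: comm_group G by fact
  show "comm_group (cochains C G n)" for n
    unfolding cochains_def by (rule comm_group_hom_group[OF C.is_group assms])
  show "coboundary C n \<in> hom (cochains C G n) (cochains C G (n + 1))" for n
    unfolding cochains_def coboundary_def
    by (rule compose_hom_group[OF C.is_group bdry_Suc_hom])
  fix \<phi> n assume "\<phi> \<in> carrier (cochains C G n)"
  then have "group_hom (chains C n) G \<phi>"
    by unfold_locales (simp add: cochain_carrier_iff)
  then show "coboundary C (n + 1) (coboundary C n \<phi>) = \<one>\<^bsub>cochains C G (n + 1 + 1)\<^esub>"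
    using bdry_Suc_bdry_Suc[of _ n] bdry_Suc_closed[of _ "n + 1"]
    by (auto simp: coboundary_def compose_def cochains_def hom_group_def group_hom.hom_one
        intro!: restrict_ext)
qed

end

lemma cohomology_eq:
  assumes "chain_cpx C" "comm_group G"
  shows "cochain_complex.Z (cochains C G) (coboundary C) n = cocycles C G n"
    and "cochain_complex.B (cochains C G) (coboundary C) n = coboundaries C G n"
    and "cochain_complex.H (cochains C G) (coboundary C) n = cohomology C G n"
proof -
  interpret chain_cpx C by fact
  interpret cochain_complex "cochains C G" "coboundary C"
    by (rule cochain_complex_cochains) fact
  show "Z n = cocycles C G n" "B n = coboundaries C G n" "H n = cohomology C G n"
    by (simp_all add: Z_def B_def H_def cocycles_def coboundaries_def cohomology_def)
qed

locale chain_morphism = C: chain_cpx C + D: chain_cpx D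
  for C :: "'c chain_complex" and D :: "'d chain_complex" +
  fixes f :: "int \<Rightarrow> 'c \<Rightarrow> 'd"
  assumes f_hom: "f n \<in> hom (chains C n) (chains D n)"
    and f_bdry: "x \<in> carrier (chains C n) \<Longrightarrow> f (n - 1) (bdry C n x) = bdry D n (f n x)"
begin

lemma f_closed: "x \<in> carrier (chains C n) \<Longrightarrow> f n x \<in> carrier (chains D n)"
  using f_hom hom_in_carrier by metis

lemma cochain_morphism:
  assumes G: "comm_group G"
  shows "cochain_morphism (cochains D G) (coboundary D) (cochains C G) (coboundary C) (cochain_map C f)"
proof (intro cochain_morphism.intro cochain_morphism_axioms.intro
    C.cochain_complex_cochains D.cochain_complex_cochains G)
  show "cochain_map C f n \<in> hom (cochains D G n) (cochains C G n)" for n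
    unfolding cochains_def cochain_map_def by (rule compose_hom_group[OF C.C.is_group f_hom])
  show "cochain_map C f (n + 1) (coboundary D n \<phi>) = coboundary C n (cochain_map C f n \<phi>)" for n \<phi>
    using f_bdry[of _ "n + 1"]
    by (auto simp: cochain_map_def coboundary_def compose_def f_closed C.bdry_Suc_closed intro!: restrict_ext)
qed

end

text \<open>A subcomplex whose chain groups are retracts of the ambient ones. The retractions need not be
  chain maps; they make restriction of cochains surjective.\<close>

locale retract_subcomplex = C: chain_cpx C + D: chain_cpx D
  for C :: "'c chain_complex" and D :: "'c chain_complex" +
  assumes subset: "carrier (chains D n) \<subseteq> carrier (chains C n)"
    and chains_eq: "chains D n = (chains C n)\<lparr>carrier := carrier (chains D n)\<rparr>"
    and bdry_eq: "x \<in> carrier (chains D n) \<Longrightarrow> bdry D n x = bdry C n x"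
    and retraction: "\<exists>r\<in>hom (chains C n) (chains D n). \<forall>x\<in>carrier (chains D n). r x = x"
begin

lemma subgroup_D: "subgroup (carrier (chains D n)) (chains C n)"
proof -
  have "Group.group ((chains C n)\<lparr>carrier := carrier (chains D n)\<rparr>)"
    using D.C.is_group chains_eq by metis
  then show ?thesis
    using C.C.group_incl_imp_subgroup subset by metis
qed

lemma inclusion: "chain_morphism D C (\<lambda>_. id)"
proof
  show "id \<in> hom (chains D n) (chains C n)" for n
    using subset[of n] by (subst chains_eq) (auto simp: hom_def)
qed (simp add: bdry_eq)

sublocale inclusion: chain_morphism D C "\<lambda>_. id"
  by (rule inclusion)

abbreviation "Q \<equiv> quotient_complex C D"
abbreviation "q \<equiv> quotient_proj C D"

lemma chains_Q: "chains Q n = chains C n Mod carrier (chains D n)"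
  by (simp add: quotient_complex_def)

lemma carrier_Q: "carrier (chains Q n) = q n ` carrier (chains C n)"
  by (auto simp: chains_Q carrier_FactGroup quotient_proj_def)

lemma one_Q: "\<one>\<^bsub>chains Q n\<^esub> = q n \<one>\<^bsub>chains C n\<^esub>"
  using subgroup_D by (simp add: chains_Q quotient_proj_def C.C.coset_join2 subgroup.one_closed)

lemma q_hom: "q n \<in> hom (chains C n) (chains Q n)"
  by (rule homI) (simp add: carrier_Q, simp add: chains_Q quotient_proj_def C.C.rcos_mult[OF subgroup_D])

lemma bdry_D: "bdry C n ` carrier (chains D n) \<subseteq> carrier (chains D (n - 1))"
  using bdry_eq[of _ n] hom_in_carrier[OF D.bdry_hom] by fastforce

lemma bdry_q: "x \<in> carrier (chains C n) \<Longrightarrow> bdry Q n (q n x) = q (n - 1) (bdry C n x)"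
  unfolding quotient_proj_def
  by (simp add: quotient_complex_def
      coset_map_r_coset[OF C.bdry_hom C.comm_group C.comm_group subgroup_D subgroup_D bdry_D])

lemma chain_cpx_Q: "chain_cpx Q"
proof (rule chain_cpx.intro)
  show "comm_group (chains Q n)" for n
    unfolding chains_Q by (rule C.C.abelian_FactGroup[OF subgroup_D])
  show "bdry Q n \<in> hom (chains Q n) (chains Q (n - 1))" for n
    using coset_map_hom[OF C.bdry_hom C.comm_group C.comm_group subgroup_D subgroup_D bdry_D]
    by (simp add: quotient_complex_def)
  fix x n assume "x \<in> carrier (chains Q n)"
  then show "bdry Q (n - 1) (bdry Q n x) = \<one>\<^bsub>chains Q (n - 1 - 1)\<^esub>"
    by (auto simp: carrier_Q bdry_q C.bdry_bdry one_Q simp del: diff_diff_eq)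
qed

lemma projection: "chain_morphism C Q q"
  by (intro chain_morphism.intro chain_morphism_axioms.intro C.chain_cpx_axioms chain_cpx_Q q_hom)
    (simp add: bdry_q)

sublocale projection: chain_morphism C Q q
  by (rule projection)

lemma q_eq_one_iff:
  "x \<in> carrier (chains C n) \<Longrightarrow> q n x = \<one>\<^bsub>chains Q n\<^esub> \<longleftrightarrow> x \<in> carrier (chains D n)"
  using C.C.r_coset_eq_self_iff[OF subgroup_D] by (simp add: chains_Q quotient_proj_def)

text \<open>Dualising \<open>0 \<rightarrow> D \<rightarrow> C \<rightarrow> C/D \<rightarrow> 0\<close> preserves exactness: on the left and in the middle always, by
  the universal property of the quotient, and on the right because of the retractions.\<close>

lemma cochain_ses:
  assumes G: "comm_group G"
  shows "cochain_ses (cochains Q G) (coboundary Q) (cochains C G) (coboundary C)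
    (cochains D G) (coboundary D) (cochain_map C q) (cochain_map D (\<lambda>_. id))"
proof (intro cochain_ses.intro cochain_ses_axioms.intro projection.cochain_morphism
    inclusion.cochain_morphism G)
  interpret G: comm_group G by (rule G)
  interpret p: cochain_morphism "cochains C G" "coboundary C" "cochains D G" "coboundary D"
    "cochain_map D (\<lambda>_. id)"
    by (rule inclusion.cochain_morphism[OF G])
  interpret j: cochain_morphism "cochains Q G" "coboundary Q" "cochains C G" "coboundary C"
    "cochain_map C q"
    by (rule projection.cochain_morphism[OF G])
  fix n
  show "inj_on (cochain_map C q n) (carrier (cochains Q G n))"
  proof (rule inj_onI)
    fix \<phi> \<psi>
    assume \<phi>: "\<phi> \<in> carrier (cochains Q G n)" and \<psi>: "\<psi> \<in> carrier (cochains Q G n)"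
      and eq: "cochain_map C q n \<phi> = cochain_map C q n \<psi>"
    show "\<phi> = \<psi>"
    proof (rule projection.D.cochain_eqI[OF \<phi> \<psi>])
      fix y assume "y \<in> carrier (chains Q n)"
      then obtain x where x: "x \<in> carrier (chains C n)" "y = q n x" by (auto simp: carrier_Q)
      then show "\<phi> y = \<psi> y"
        using fun_cong[OF eq, of x] by (simp add: cochain_map_def compose_def)
    qed
  qed
  show "cochain_map D (\<lambda>_. id) n ` carrier (cochains C G n) = carrier (cochains D G n)"
  proof (intro equalityI subsetI)
    fix \<phi> assume \<phi>: "\<phi> \<in> carrier (cochains D G n)"
    obtain r where r: "r \<in> hom (chains C n) (chains D n)" "\<forall>x\<in>carrier (chains D n). r x = x"
      using retraction by blast
    let ?\<eta> = "compose (carrier (chains C n)) \<phi> r"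
    have \<eta>: "?\<eta> \<in> carrier (cochains C G n)"
      using hom_in_carrier[OF compose_hom_group[OF C.C.is_group r(1)]] \<phi> by (simp add: cochains_def)
    have "cochain_map D (\<lambda>_. id) n ?\<eta> = \<phi>"
      using \<phi> p.f.hom_closed[OF \<eta>] r(2) subset[of n]
      by (intro D.cochain_eqI) (auto simp: cochain_map_def compose_def)
    then show "\<phi> \<in> cochain_map D (\<lambda>_. id) n ` carrier (cochains C G n)"
      using \<eta> by force
  qed (use p.f.hom_closed in blast)
  show "cochain_map C q n ` carrier (cochains Q G n) =
    kernel (cochains C G n) (cochains D G n) (cochain_map D (\<lambda>_. id) n)"
  proof (intro equalityI subsetI)
    fix \<eta> assume "\<eta> \<in> cochain_map C q n ` carrier (cochains Q G n)"
    then obtain \<psi> where \<psi>: "\<psi> \<in> carrier (cochains Q G n)" and \<eta>: "\<eta> = cochain_map C q n \<psi>" by blast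
    have "group_hom (chains Q n) G \<psi>"
      using \<psi> projection.D.cochain_carrier_iff[of \<psi> G n]
      by (simp add: group_hom_def group_hom_axioms_def projection.D.C.is_group)
    then have "\<psi> (q n x) = \<one>\<^bsub>G\<^esub>" if "x \<in> carrier (chains D n)" for x
      using that subset[of n] q_eq_one_iff[of x n] group_hom.hom_one by fastforce
    then have "cochain_map D (\<lambda>_. id) n \<eta> = \<one>\<^bsub>cochains D G n\<^esub>"
      using subset[of n]
      by (auto simp: \<eta> cochain_map_def compose_def cochains_def hom_group_def intro!: restrict_ext)
    then show "\<eta> \<in> kernel (cochains C G n) (cochains D G n) (cochain_map D (\<lambda>_. id) n)"
      using \<psi> by (simp add: kernel_def \<eta>)
  next
    fix \<eta> assume "\<eta> \<in> kernel (cochains C G n) (cochains D G n) (cochain_map D (\<lambda>_. id) n)"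
    then have \<eta>: "\<eta> \<in> carrier (cochains C G n)"
      and zero: "cochain_map D (\<lambda>_. id) n \<eta> = \<one>\<^bsub>cochains D G n\<^esub>"
      by (auto simp: kernel_def)
    interpret \<eta>: group_hom "chains C n" G \<eta>
      using \<eta> by unfold_locales (simp add: C.cochain_carrier_iff)
    have \<eta>_D: "\<eta> x = \<one>\<^bsub>G\<^esub>" if "x \<in> carrier (chains D n)" for x
      using fun_cong[OF zero, of x] that
      by (simp add: cochain_map_def compose_def cochains_def hom_group_def)
    have "\<eta> x = \<eta> y" if "x \<in> carrier (chains C n)" "y \<in> carrier (chains C n)"
      "carrier (chains D n) #>\<^bsub>chains C n\<^esub> x = carrier (chains D n) #>\<^bsub>chains C n\<^esub> y" for x y
      using that subset[of n] \<eta>_D by (auto simp: C.C.r_coset_eq_iff[OF subgroup_D])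
    then obtain \<psi> where \<psi>: "\<psi> \<in> hom (chains Q n) G"
      "\<And>x. x \<in> carrier (chains C n) \<Longrightarrow> \<psi> (q n x) = \<eta> x"
      using FactGroup_universal[OF \<eta>.homh C.C.subgroup_imp_normal[OF subgroup_D]]
      unfolding quotient_proj_def chains_Q by metis
    let ?\<psi> = "restrict \<psi> (carrier (chains Q n))"
    have \<psi>': "?\<psi> \<in> carrier (cochains Q G n)"
      using \<psi>(1) by (auto simp: projection.D.cochain_carrier_iff hom_def Pi_def)
    have "cochain_map C q n ?\<psi> = \<eta>"
      using \<psi>(2) by (intro C.cochain_eqI[OF j.f.hom_closed[OF \<psi>'] \<eta>])
        (auto simp: cochain_map_def compose_def carrier_Q)
    then show "\<eta> \<in> cochain_map C q n ` carrier (cochains Q G n)"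
      using \<psi>' by force
  qed
qed

lemma connecting_eq:
  assumes "comm_group G"
  shows "cochain_ses.connecting (cochains Q G) (coboundary Q) (cochains C G) (coboundary C)
    (cochain_map C q) (cochain_map D (\<lambda>_. id)) n = connecting_hom C D G n"
  by (simp add: fun_eq_iff cochain_ses.connecting_def[OF cochain_ses[OF assms]] connecting_hom_def
      cohomology_eq[OF chain_cpx_Q assms])

end

lemma group_cohomology:
  assumes "chain_cpx C" "comm_group G"
  shows "Group.group (cohomology C G n)"
proof -
  interpret chain_cpx C by fact
  interpret cochain_complex "cochains C G" "coboundary C"
    by (rule cochain_complex_cochains) fact
  show ?thesis
    using H.is_group[of n] by (simp add: cohomology_eq[OF assms])
qed

lemma cohomology_map_hom:
  assumes "chain_morphism C D f" "comm_group G"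
  shows "cohomology_map C G f n \<in> hom (cohomology D G n) (cohomology C G n)"
proof -
  interpret chain_morphism C D f by fact
  interpret m: cochain_morphism "cochains D G" "coboundary D" "cochains C G" "coboundary C" "cochain_map C f"
    by (rule cochain_morphism) fact
  show ?thesis
    using m.induced_hom[of n]
    by (simp add: cohomology_map_def cohomology_eq[OF C.chain_cpx_axioms assms(2)]
        cohomology_eq[OF D.chain_cpx_axioms assms(2)])
qed

lemma cohomology_map_comp:
  assumes "chain_morphism C D f" "chain_morphism D E g" "chain_morphism C E h" "comm_group G"
    and gf: "\<And>x. x \<in> carrier (chains C n) \<Longrightarrow> g n (f n x) = h n x"
    and c: "c \<in> carrier (cohomology E G n)"
  shows "cohomology_map C G f n (cohomology_map D G g n c) = cohomology_map C G h n c"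
proof -
  interpret f: chain_morphism C D f by fact
  interpret g: chain_morphism D E g by fact
  interpret h: chain_morphism C E h by fact
  have "cochain_map C f n (cochain_map D g n \<phi>) = cochain_map C h n \<phi>"
    if "\<phi> \<in> carrier (cochains E G n)" for \<phi>
    using gf by (auto simp: cochain_map_def compose_def f.f_closed intro!: restrict_ext)
  then show ?thesis
    using induced_comp[OF g.cochain_morphism[OF assms(4)] f.cochain_morphism[OF assms(4)]
        h.cochain_morphism[OF assms(4)], of n c] c
    by (simp add: cohomology_map_def cohomology_eq[OF f.C.chain_cpx_axioms assms(4)]
        cohomology_eq[OF f.D.chain_cpx_axioms assms(4)] cohomology_eq[OF g.D.chain_cpx_axioms assms(4)])
qed

lemma chain_morphism_comp:
  assumes "chain_morphism C D f" "chain_morphism D E g"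
  shows "chain_morphism C E (\<lambda>n x. g n (f n x))"
proof -
  interpret f: chain_morphism C D f by fact
  interpret g: chain_morphism D E g by fact
  show ?thesis
  proof (intro chain_morphism.intro chain_morphism_axioms.intro f.C.chain_cpx_axioms g.D.chain_cpx_axioms)
    show "(\<lambda>x. g n (f n x)) \<in> hom (chains C n) (chains E n)" for n
      using hom_compose[OF f.f_hom g.f_hom] by (simp add: comp_def)
  qed (simp add: f.f_bdry g.f_bdry f.f_closed)
qed

lemma cohomology_map_square:
  assumes f: "chain_morphism C D f" and g: "chain_morphism D E g"
    and f': "chain_morphism C D' f'" and g': "chain_morphism D' E g'" and G: "comm_group G"
    and eq: "\<And>x. x \<in> carrier (chains C n) \<Longrightarrow> g n (f n x) = g' n (f' n x)"
    and c: "c \<in> carrier (cohomology E G n)"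
  shows "cohomology_map C G f n (cohomology_map D G g n c) =
    cohomology_map C G f' n (cohomology_map D' G g' n c)"
  using cohomology_map_comp[OF f g chain_morphism_comp[OF f g] G refl c]
    cohomology_map_comp[OF f' g' chain_morphism_comp[OF f g] G eq[symmetric] c] by simp

text \<open>An inclusion of pairs \<open>(C, D) \<subseteq> (C', D')\<close>, as between the pairs of complexes for \<open>\<mu> \<le> \<epsilon>\<close>.\<close>

locale pair_inclusion =
  S: retract_subcomplex C D + S': retract_subcomplex C' D' +
  CC: retract_subcomplex C' C + DD: retract_subcomplex D' D
  for C D C' D' :: "'c chain_complex"
begin

abbreviation "T n \<equiv> coset_map (chains C' n) (carrier (chains D' n)) id"

lemma id_D: "id ` carrier (chains D n) \<subseteq> carrier (chains D' n)"
  using DD.subset by simp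

lemma T_q: "x \<in> carrier (chains C n) \<Longrightarrow> T n (S.q n x) = S'.q n x"
  unfolding quotient_proj_def
  using coset_map_r_coset[OF CC.inclusion.f_hom S.C.comm_group S'.C.comm_group S.subgroup_D
      S'.subgroup_D id_D] by simp

lemma quotient_map: "chain_morphism S.Q S'.Q T"
proof (intro chain_morphism.intro chain_morphism_axioms.intro S.chain_cpx_Q S'.chain_cpx_Q)
  show "T n \<in> hom (chains S.Q n) (chains S'.Q n)" for n
    unfolding S.chains_Q S'.chains_Q
    by (rule coset_map_hom[OF CC.inclusion.f_hom S.C.comm_group S'.C.comm_group S.subgroup_D
      S'.subgroup_D id_D])
  fix y n assume "y \<in> carrier (chains S.Q n)"
  then obtain x where x: "x \<in> carrier (chains C n)" "y = S.q n x" by (auto simp: S.carrier_Q)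
  then have "x \<in> carrier (chains C' n)" using CC.subset by blast
  then show "T (n - 1) (bdry S.Q n y) = bdry S'.Q n (T n y)"
    using x S.C.bdry.hom_closed[of x n] by (simp add: S.bdry_q S'.bdry_q T_q flip: CC.bdry_eq)
qed

lemma connecting_hom_natural:
  assumes G: "comm_group G" and c: "c \<in> carrier (cohomology D' G n)"
  shows "connecting_hom C D G n (cohomology_map D G (\<lambda>_. id) n c) =
    cohomology_map S.Q G T (n + 1) (connecting_hom C' D' G n c)"
proof -
  interpret T: chain_morphism S.Q S'.Q T by (rule quotient_map)
  have sq1: "cochain_map C (\<lambda>_. id) (n + 1) (cochain_map C' S'.q (n + 1) \<phi>) =
      cochain_map C S.q (n + 1) (cochain_map S.Q T (n + 1) \<phi>)"
    if "\<phi> \<in> carrier (cochains S'.Q G (n + 1))" for \<phi>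
    using CC.subset[of "n + 1"]
    by (auto simp: cochain_map_def compose_def S.projection.f_closed T_q intro!: restrict_ext)
  have sq2: "cochain_map D (\<lambda>_. id) n (cochain_map D' (\<lambda>_. id) n \<phi>) =
      cochain_map D (\<lambda>_. id) n (cochain_map C (\<lambda>_. id) n \<phi>)"
    if "\<phi> \<in> carrier (cochains C' G n)" for \<phi>
    using DD.subset[of n] S.subset[of n]
    by (auto simp: cochain_map_def compose_def intro!: restrict_ext)
  note natural = connecting_natural[OF S'.cochain_ses[OF G] S.cochain_ses[OF G] T.cochain_morphism[OF G]
    CC.inclusion.cochain_morphism[OF G] DD.inclusion.cochain_morphism[OF G], of n c]
  show ?thesis
    using natural[OF sq1 sq2] c
    by (simp add: S.connecting_eq[OF G] S'.connecting_eq[OF G] cohomology_map_def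
        cohomology_eq[OF S.D.chain_cpx_axioms G] cohomology_eq[OF S'.D.chain_cpx_axioms G]
        cohomology_eq[OF S.chain_cpx_Q G])
qed

end

context retract_subcomplex
begin

context
  fixes G :: "'g monoid"
  assumes G: "comm_group G"
begin

interpretation ses: cochain_ses "cochains Q G" "coboundary Q" "cochains C G" "coboundary C"
    "cochains D G" "coboundary D" "cochain_map C q" "cochain_map D (\<lambda>_. id)"
  by (rule cochain_ses[OF G])

lemmas ses_eq = cohomology_eq[OF chain_cpx_Q G] cohomology_eq[OF C.chain_cpx_axioms G]
  cohomology_eq[OF D.chain_cpx_axioms G] connecting_eq[OF G] cohomology_map_def[symmetric]

lemmas connecting_hom = ses.connecting_hom[unfolded ses_eq]
lemmas exact_at_C = ses.exact_at_L[unfolded ses_eq]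
lemmas exact_at_D = ses.exact_at_M[unfolded ses_eq]
lemmas exact_at_Q = ses.exact_at_K[unfolded ses_eq]

end

end


section \<open>The complex of almost continuous singular simplices\<close>

text \<open>The face map inserts a zero coordinate, which does not change sums. Applied to the squared
  coordinate differences, this shows that face maps are isometric.\<close>

lemma sum_simplical_face:
  fixes h :: "nat \<Rightarrow> 'a::comm_monoid_add"
  assumes "k \<le> Suc q"
  shows "(\<Sum>i\<le>Suc q. simplical_face k h i) = (\<Sum>i\<le>q. h i)"
  using assms
proof (induction q)
  case 0
  then have "k = 0 \<or> k = 1" by auto
  then show ?case by (auto simp: simplical_face_def)
next
  case (Suc q)
  show ?case
  proof (cases "k = Suc (Suc q)")
    case True
    then have "(\<Sum>i\<le>Suc q. simplical_face k h i) = (\<Sum>i\<le>Suc q. h i)"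
      by (intro sum.cong) (auto simp: simplical_face_def)
    then show ?thesis
      using True by (simp add: simplical_face_def)
  next
    case False
    then show ?thesis
      using Suc by (simp add: simplical_face_def)
  qed
qed

lemma simplex_dist_simplical_face:
  assumes "k \<le> Suc q"
  shows "simplex_dist (Suc q) (simplical_face k x) (simplical_face k y) = simplex_dist q x y"
proof -
  have "(simplical_face k x i - simplical_face k y i)\<^sup>2 = simplical_face k (\<lambda>i. (x i - y i)\<^sup>2) i" for i
    by (simp add: simplical_face_def)
  then show ?thesis
    using sum_simplical_face[OF assms, of "\<lambda>i. (x i - y i)\<^sup>2"]
    by (simp add: simplex_dist_def L2_set_def)
qed

text \<open>The same \<open>\<delta>\<close> works for a face as for the simplex, by isometry of the face map.\<close>

lemma singular_face_eps_simplex: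
  assumes "\<sigma> \<in> eps_singular_simplices X d \<epsilon> (Suc q)" and k: "k \<le> Suc q"
  shows "singular_face (Suc q) k \<sigma> \<in> eps_singular_simplices X d \<epsilon> q"
proof -
  have \<sigma>: "\<sigma> \<in> standard_simplex (Suc q) \<rightarrow>\<^sub>E X"
    "eps_continuous \<epsilon> (standard_simplex (Suc q)) (simplex_dist (Suc q)) d \<sigma>"
    using assms by (auto simp: eps_singular_simplices_def)
  let ?S = "\<lambda>q \<delta> \<sigma>. {ereal (d (\<sigma> x1) (\<sigma> x2)) |x1 x2.
    x1 \<in> standard_simplex q \<and> x2 \<in> standard_simplex q \<and> simplex_dist q x1 x2 < \<delta>}"
  have face: "simplical_face k x \<in> standard_simplex (Suc q)" if "x \<in> standard_simplex q" for x :: "nat \<Rightarrow> real"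
    using simplical_face_in_standard_simplex[of "Suc q" k x] that k by simp
  obtain \<delta> where \<delta>: "\<delta> > 0" "Sup (?S (Suc q) \<delta> \<sigma>) < ereal \<epsilon>"
    using \<sigma>(2) unfolding eps_continuous_def by blast
  have "?S q \<delta> (singular_face (Suc q) k \<sigma>) \<subseteq> ?S (Suc q) \<delta> \<sigma>"
    using face k by (fastforce simp: singular_face_def simplex_dist_simplical_face)
  then have "Sup (?S q \<delta> (singular_face (Suc q) k \<sigma>)) < ereal \<epsilon>"
    using \<delta>(2) Sup_subset_mono le_less_trans by blast
  then have "eps_continuous \<epsilon> (standard_simplex q) (simplex_dist q) d (singular_face (Suc q) k \<sigma>)"
    unfolding eps_continuous_def using \<delta>(1) by blast
  moreover have "singular_face (Suc q) k \<sigma> \<in> standard_simplex q \<rightarrow>\<^sub>E X"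
    using \<sigma>(1) face by (auto simp: singular_face_def)
  ultimately show ?thesis by (simp add: eps_singular_simplices_def)
qed

lemma eps_singular_simplices_mono:
  assumes "A \<subseteq> X" "\<mu> \<le> \<epsilon>"
  shows "eps_singular_simplices A d \<mu> n \<subseteq> eps_singular_simplices X d \<epsilon> n"
proof
  fix \<sigma> assume "\<sigma> \<in> eps_singular_simplices A d \<mu> n"
  moreover have "ereal \<mu> \<le> ereal \<epsilon>" using assms by simp
  ultimately show "\<sigma> \<in> eps_singular_simplices X d \<epsilon> n"
    using assms(1) unfolding eps_singular_simplices_def eps_continuous_def
    by (blast intro: less_le_trans dest: PiE_mono[THEN subsetD, rotated])
qed

text \<open>In the coarse topology every map is continuous, so arbitrary extensional maps on simplices
  are singular simplices of that space, and the classical identity applies to them.\<close>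

lemma chain_boundary_boundary_coarse:
  fixes c :: "'a chain"
  assumes "Poly_Mapping.keys c \<subseteq> extensional (standard_simplex p)"
  shows "chain_boundary (p - 1) (chain_boundary p c) = 0"
proof -
  have "continuous_map (subtopology (powertop_real UNIV) (standard_simplex p))
      (topology_generated_by {UNIV :: 'a set}) \<sigma>" for \<sigma>
    unfolding continuous_on_generated_topo_iff
    using openin_topspace[of "subtopology (powertop_real UNIV) (standard_simplex p)"] by auto
  then have "singular_chain p (topology_generated_by {UNIV}) c"
    using assms by (auto simp: singular_chain_def singular_simplex_def)
  then show ?thesis
    using chain_boundary_boundary by simp
qed

lemma eps_complex_simps:
  "chains (eps_complex X d \<epsilon>) n =
    free_Abelian_group (if n < 0 then {} else eps_singular_simplices X d \<epsilon> (nat n))"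
  "bdry (eps_complex X d \<epsilon>) n = chain_boundary (nat n)"
  by (simp_all add: eps_complex_def)

lemma keys_chain_boundary:
  assumes "Poly_Mapping.keys c \<subseteq> eps_singular_simplices X d \<epsilon> (Suc q)"
  shows "Poly_Mapping.keys (chain_boundary (Suc q) c) \<subseteq> eps_singular_simplices X d \<epsilon> q"
proof -
  let ?S = "eps_singular_simplices X d \<epsilon>"
  have "chain_boundary (Suc q) c \<in> carrier (free_Abelian_group (?S q))"
  proof (rule free_Abelian_group_induct[OF assms])
    fix x y :: "'a chain"
    assume "chain_boundary (Suc q) x \<in> carrier (free_Abelian_group (?S q))"
      "chain_boundary (Suc q) y \<in> carrier (free_Abelian_group (?S q))"
    then show "chain_boundary (Suc q) (x - y) \<in> carrier (free_Abelian_group (?S q))"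
      using keys_diff[of "chain_boundary (Suc q) x" "chain_boundary (Suc q) y"]
      by (auto simp: chain_boundary_diff)
  next
    fix \<sigma> assume \<sigma>: "\<sigma> \<in> ?S (Suc q)"
    have "frag_cmul ((-1) ^ k) (frag_of (singular_face (Suc q) k \<sigma>)) \<in> carrier (free_Abelian_group (?S q))"
      if "k \<le> Suc q" for k
      using keys_cmul[of "(-1) ^ k" "frag_of (singular_face (Suc q) k \<sigma>)"]
        singular_face_eps_simplex[OF \<sigma> that] by auto
    then show "chain_boundary (Suc q) (frag_of \<sigma>) \<in> carrier (free_Abelian_group (?S q))"
      unfolding chain_boundary_of
      by (simp only: nat.distinct if_False) (intro sum_closed_free_Abelian_group, simp)
  qed simp
  then show ?thesis by simp
qed

lemma chain_cpx_eps: "chain_cpx (eps_complex X d \<epsilon>)"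
proof (rule chain_cpx.intro)
  show "comm_group (chains (eps_complex X d \<epsilon>) n)" for n
    by (simp add: eps_complex_simps abelian_free_Abelian_group)
  show "bdry (eps_complex X d \<epsilon>) n
      \<in> hom (chains (eps_complex X d \<epsilon>) n) (chains (eps_complex X d \<epsilon>) (n - 1))" for n
  proof (rule homI)
    fix c assume c: "c \<in> carrier (chains (eps_complex X d \<epsilon>) n)"
    show "bdry (eps_complex X d \<epsilon>) n c \<in> carrier (chains (eps_complex X d \<epsilon>) (n - 1))"
    proof (cases "n \<le> 0")
      case True
      then show ?thesis by (simp add: eps_complex_simps chain_boundary_def)
    next
      case False
      define q where "q = nat (n - 1)"
      have "nat n = Suc q" using False by (simp add: q_def)
      then show ?thesis
        using c False keys_chain_boundary[of c X d \<epsilon> q] by (simp add: eps_complex_simps q_def)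
    qed
  qed (simp add: eps_complex_simps chain_boundary_add)
  fix c n assume c: "c \<in> carrier (chains (eps_complex X d \<epsilon>) n)"
  have "Poly_Mapping.keys c \<subseteq> extensional (standard_simplex (nat n))"
    using c by (auto simp: eps_complex_simps eps_singular_simplices_def PiE_def split: if_splits)
  then have "chain_boundary (nat n - 1) (chain_boundary (nat n) c) = 0"
    by (rule chain_boundary_boundary_coarse)
  moreover have "nat (n - 1) = nat n - 1" by arith
  ultimately show "bdry (eps_complex X d \<epsilon>) (n - 1) (bdry (eps_complex X d \<epsilon>) n c) =
      \<one>\<^bsub>chains (eps_complex X d \<epsilon>) (n - 1 - 1)\<^esub>"
    by (simp add: eps_complex_simps)
qed

text \<open>A free abelian group on a subset is a retract: send the remaining generators to zero.\<close>

lemma free_Abelian_group_retraction: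
  assumes "S \<subseteq> T"
  shows "\<exists>r\<in>hom (free_Abelian_group T) (free_Abelian_group S).
    \<forall>x\<in>carrier (free_Abelian_group S). r x = x"
proof -
  let ?f = "\<lambda>x. if x \<in> S then frag_of x else 0"
  have "frag_extend ?f \<in> hom (free_Abelian_group T) (free_Abelian_group S)"
  proof (rule homI)
    fix x
    show "frag_extend ?f x \<in> carrier (free_Abelian_group S)"
      using keys_frag_extend[of ?f x] by (auto split: if_splits)
  qed (simp add: frag_extend_add)
  moreover have "frag_extend ?f x = x" if "x \<in> carrier (free_Abelian_group S)" for x
  proof -
    have "frag_extend ?f x = frag_extend frag_of x"
      using that by (intro frag_extend_eq) auto
    then show ?thesis using frag_expansion[of x] by simp
  qed
  ultimately show ?thesis by blast
qed

lemma retract_subcomplex_eps: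
  assumes "A \<subseteq> X" "\<mu> \<le> \<epsilon>"
  shows "retract_subcomplex (eps_complex X d \<epsilon>) (eps_complex A d \<mu>)"
proof (intro retract_subcomplex.intro retract_subcomplex_axioms.intro chain_cpx_eps)
  fix n
  let ?S = "if n < 0 then {} else eps_singular_simplices A d \<mu> (nat n)"
  let ?T = "if n < 0 then {} else eps_singular_simplices X d \<epsilon> (nat n)"
  have sub: "?S \<subseteq> ?T"
    using eps_singular_simplices_mono[OF assms] by auto
  show "carrier (chains (eps_complex A d \<mu>) n) \<subseteq> carrier (chains (eps_complex X d \<epsilon>) n)"
    unfolding eps_complex_simps using sub by (auto simp del: if_split)
  show "chains (eps_complex A d \<mu>) n =
      (chains (eps_complex X d \<epsilon>) n)\<lparr>carrier := carrier (chains (eps_complex A d \<mu>) n)\<rparr>"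
    by (simp add: eps_complex_simps free_Abelian_group_def)
  show "\<exists>r\<in>hom (chains (eps_complex X d \<epsilon>) n) (chains (eps_complex A d \<mu>) n).
      \<forall>x\<in>carrier (chains (eps_complex A d \<mu>) n). r x = x"
    unfolding eps_complex_simps by (rule free_Abelian_group_retraction[OF sub])
qed (simp add: eps_complex_simps)

section \<open>The lc-cohomology sequence of a pair\<close>

lemma directed_system_pos:
  fixes K :: "real \<Rightarrow> 'a monoid"
  assumes "\<And>\<epsilon>. \<epsilon> > 0 \<Longrightarrow> Group.group (K \<epsilon>)"
    and "\<And>\<epsilon> \<mu>. 0 < \<mu> \<Longrightarrow> \<mu> \<le> \<epsilon> \<Longrightarrow> t \<epsilon> \<mu> \<in> hom (K \<epsilon>) (K \<mu>)"
    and "\<And>\<epsilon> \<mu> \<nu> x. 0 < \<nu> \<Longrightarrow> \<nu> \<le> \<mu> \<Longrightarrow> \<mu> \<le> \<epsilon> \<Longrightarrow> x \<in> carrier (K \<epsilon>) \<Longrightarrow> t \<mu> \<nu> (t \<epsilon> \<mu> x) = t \<epsilon> \<nu> x"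
  shows "directed_system {0<..} (\<ge>) K t"
proof (rule directed_system.intro)
  fix \<epsilon> \<mu> :: real assume "\<epsilon> \<in> {0<..}" "\<mu> \<in> {0<..}"
  then show "\<exists>\<nu>\<in>{0<..}. \<nu> \<le> \<epsilon> \<and> \<nu> \<le> \<mu>"
    by (intro bexI[of _ "min \<epsilon> \<mu>"]) auto
qed (use assms in auto)

lemma directed_system_eps:
  assumes G: "comm_group G"
  shows "directed_system {0<..} (\<ge>) (\<lambda>\<epsilon>. cohomology (eps_complex X d \<epsilon>) G n) (eps_transition X d G n)"
proof (rule directed_system_pos)
  have inclusion: "chain_morphism (eps_complex X d \<mu>) (eps_complex X d \<epsilon>) (\<lambda>_. id)" if "\<mu> \<le> \<epsilon>" for \<mu> \<epsilon>
    using that by (intro retract_subcomplex.inclusion retract_subcomplex_eps) auto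
  show "Group.group (cohomology (eps_complex X d \<epsilon>) G n)" for \<epsilon>
    by (rule group_cohomology[OF chain_cpx_eps G])
  fix \<epsilon> \<mu> :: real assume \<mu>: "\<mu> \<le> \<epsilon>"
  show "eps_transition X d G n \<epsilon> \<mu> \<in>
      hom (cohomology (eps_complex X d \<epsilon>) G n) (cohomology (eps_complex X d \<mu>) G n)"
    unfolding eps_transition_def by (rule cohomology_map_hom[OF inclusion[OF \<mu>] G])
  fix \<nu> c assume \<nu>: "\<nu> \<le> \<mu>" and c: "c \<in> carrier (cohomology (eps_complex X d \<epsilon>) G n)"
  show "eps_transition X d G n \<mu> \<nu> (eps_transition X d G n \<epsilon> \<mu> c) = eps_transition X d G n \<epsilon> \<nu> c"
    unfolding eps_transition_def
    by (rule cohomology_map_comp[OF inclusion[OF \<nu>] inclusion[OF \<mu>] inclusion[OF order_trans[OF \<nu> \<mu>]] G _ c])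
      simp
qed

context
  fixes X A :: "'a set" and d :: "'a \<Rightarrow> 'a \<Rightarrow> real" and G :: "'g monoid"
  assumes A: "A \<subseteq> X" and G: "comm_group G"
begin

abbreviation "CX \<equiv> eps_complex X d"
abbreviation "CA \<equiv> eps_complex A d"
abbreviation "CR \<epsilon> \<equiv> quotient_complex (CX \<epsilon>) (CA \<epsilon>)"
abbreviation "TR \<epsilon> n \<equiv> coset_map (chains (CX \<epsilon>) n) (carrier (chains (CA \<epsilon>) n)) id"

interpretation pair: retract_subcomplex "CX \<epsilon>" "CA \<epsilon>" for \<epsilon>
  by (rule retract_subcomplex_eps) (use A in auto)

lemma pair_inclusion_eps: "\<mu> \<le> \<epsilon> \<Longrightarrow> pair_inclusion (CX \<mu>) (CA \<mu>) (CX \<epsilon>) (CA \<epsilon>)"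
  using A by (intro pair_inclusion.intro retract_subcomplex_eps) auto

lemma directed_system_eps_rel:
  "directed_system {0<..} (\<ge>) (\<lambda>\<epsilon>. cohomology (eps_rel_complex X A d \<epsilon>) G n) (eps_rel_transition X A d G n)"
  unfolding eps_rel_complex_def
proof (rule directed_system_pos)
  show "Group.group (cohomology (CR \<epsilon>) G n)" for \<epsilon>
    by (rule group_cohomology[OF pair.chain_cpx_Q G])
  fix \<epsilon> \<mu> :: real assume \<mu>: "\<mu> \<le> \<epsilon>"
  interpret \<mu>: pair_inclusion "CX \<mu>" "CA \<mu>" "CX \<epsilon>" "CA \<epsilon>" by (rule pair_inclusion_eps[OF \<mu>])
  show "eps_rel_transition X A d G n \<epsilon> \<mu> \<in> hom (cohomology (CR \<epsilon>) G n) (cohomology (CR \<mu>) G n)"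
    unfolding eps_rel_transition_def eps_rel_complex_def by (rule cohomology_map_hom[OF \<mu>.quotient_map G])
  fix \<nu> c assume \<nu>: "\<nu> \<le> \<mu>" and c: "c \<in> carrier (cohomology (CR \<epsilon>) G n)"
  interpret \<nu>: pair_inclusion "CX \<nu>" "CA \<nu>" "CX \<mu>" "CA \<mu>" by (rule pair_inclusion_eps[OF \<nu>])
  interpret \<nu>\<epsilon>: pair_inclusion "CX \<nu>" "CA \<nu>" "CX \<epsilon>" "CA \<epsilon>"
    by (rule pair_inclusion_eps[OF order_trans[OF \<nu> \<mu>]])
  have "TR \<epsilon> n (TR \<mu> n y) = TR \<epsilon> n y" if y: "y \<in> carrier (chains (CR \<nu>) n)" for y
  proof -
    obtain x where x: "x \<in> carrier (chains (CX \<nu>) n)" "y = quotient_proj (CX \<nu>) (CA \<nu>) n x"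
      using y by (auto simp: pair.carrier_Q)
    then have "x \<in> carrier (chains (CX \<mu>) n)" using \<nu>.CC.subset by blast
    then show ?thesis
      using x by (simp add: \<mu>.T_q \<nu>.T_q \<nu>\<epsilon>.T_q)
  qed
  then show "eps_rel_transition X A d G n \<mu> \<nu> (eps_rel_transition X A d G n \<epsilon> \<mu> c) =
      eps_rel_transition X A d G n \<epsilon> \<nu> c"
    unfolding eps_rel_transition_def eps_rel_complex_def
    by (rule cohomology_map_comp[OF \<nu>.quotient_map \<mu>.quotient_map \<nu>\<epsilon>.quotient_map G _ c])
qed

lemma from_rel_map:
  "directed_system_map {0<..} (\<ge>)
    (\<lambda>\<epsilon>. cohomology (eps_rel_complex X A d \<epsilon>) G n) (eps_rel_transition X A d G n)
    (\<lambda>\<epsilon>. cohomology (CX \<epsilon>) G n) (eps_transition X d G n)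
    (\<lambda>\<epsilon>. cohomology_map (CX \<epsilon>) G (quotient_proj (CX \<epsilon>) (CA \<epsilon>)) n)"
proof (intro directed_system_map.intro directed_system_map_axioms.intro
    directed_system_eps_rel directed_system_eps G)
  show "cohomology_map (CX \<epsilon>) G (quotient_proj (CX \<epsilon>) (CA \<epsilon>)) n
      \<in> hom (cohomology (eps_rel_complex X A d \<epsilon>) G n) (cohomology (CX \<epsilon>) G n)" for \<epsilon>
    unfolding eps_rel_complex_def by (rule cohomology_map_hom[OF pair.projection G])
  fix \<epsilon> \<mu> :: real and c
  assume \<mu>: "\<mu> \<le> \<epsilon>" and c: "c \<in> carrier (cohomology (eps_rel_complex X A d \<epsilon>) G n)"
  interpret \<mu>: pair_inclusion "CX \<mu>" "CA \<mu>" "CX \<epsilon>" "CA \<epsilon>" by (rule pair_inclusion_eps[OF \<mu>])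
  show "cohomology_map (CX \<mu>) G (quotient_proj (CX \<mu>) (CA \<mu>)) n (eps_rel_transition X A d G n \<epsilon> \<mu> c) =
      eps_transition X d G n \<epsilon> \<mu> (cohomology_map (CX \<epsilon>) G (quotient_proj (CX \<epsilon>) (CA \<epsilon>)) n c)"
    unfolding eps_rel_transition_def eps_transition_def eps_rel_complex_def
    by (rule cohomology_map_square[OF pair.projection \<mu>.quotient_map \<mu>.CC.inclusion pair.projection G])
      (use c \<mu>.T_q in \<open>simp_all add: eps_rel_complex_def\<close>)
qed

lemma restriction_map:
  "directed_system_map {0<..} (\<ge>)
    (\<lambda>\<epsilon>. cohomology (CX \<epsilon>) G n) (eps_transition X d G n)
    (\<lambda>\<epsilon>. cohomology (CA \<epsilon>) G n) (eps_transition A d G n)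
    (\<lambda>\<epsilon>. cohomology_map (CA \<epsilon>) G (\<lambda>_. id) n)"
proof (intro directed_system_map.intro directed_system_map_axioms.intro directed_system_eps G)
  show "cohomology_map (CA \<epsilon>) G (\<lambda>_. id) n \<in> hom (cohomology (CX \<epsilon>) G n) (cohomology (CA \<epsilon>) G n)" for \<epsilon>
    by (rule cohomology_map_hom[OF pair.inclusion G])
  fix \<epsilon> \<mu> :: real and c
  assume \<mu>: "\<mu> \<le> \<epsilon>" and c: "c \<in> carrier (cohomology (CX \<epsilon>) G n)"
  interpret \<mu>: pair_inclusion "CX \<mu>" "CA \<mu>" "CX \<epsilon>" "CA \<epsilon>" by (rule pair_inclusion_eps[OF \<mu>])
  show "cohomology_map (CA \<mu>) G (\<lambda>_. id) n (eps_transition X d G n \<epsilon> \<mu> c) =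
      eps_transition A d G n \<epsilon> \<mu> (cohomology_map (CA \<epsilon>) G (\<lambda>_. id) n c)"
    unfolding eps_transition_def
    by (rule cohomology_map_square[OF pair.inclusion \<mu>.CC.inclusion \<mu>.DD.inclusion pair.inclusion G refl c])
qed

lemma connecting_map:
  "directed_system_map {0<..} (\<ge>)
    (\<lambda>\<epsilon>. cohomology (CA \<epsilon>) G n) (eps_transition A d G n)
    (\<lambda>\<epsilon>. cohomology (eps_rel_complex X A d \<epsilon>) G (n + 1)) (eps_rel_transition X A d G (n + 1))
    (\<lambda>\<epsilon>. connecting_hom (CX \<epsilon>) (CA \<epsilon>) G n)"
proof (intro directed_system_map.intro directed_system_map_axioms.intro
    directed_system_eps_rel directed_system_eps G)
  show "connecting_hom (CX \<epsilon>) (CA \<epsilon>) G n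
      \<in> hom (cohomology (CA \<epsilon>) G n) (cohomology (eps_rel_complex X A d \<epsilon>) G (n + 1))" for \<epsilon>
    unfolding eps_rel_complex_def by (rule pair.connecting_hom[OF G])
  fix \<epsilon> \<mu> :: real and c
  assume \<mu>: "\<mu> \<le> \<epsilon>" and c: "c \<in> carrier (cohomology (CA \<epsilon>) G n)"
  interpret \<mu>: pair_inclusion "CX \<mu>" "CA \<mu>" "CX \<epsilon>" "CA \<epsilon>" by (rule pair_inclusion_eps[OF \<mu>])
  show "connecting_hom (CX \<mu>) (CA \<mu>) G n (eps_transition A d G n \<epsilon> \<mu> c) =
      eps_rel_transition X A d G (n + 1) \<epsilon> \<mu> (connecting_hom (CX \<epsilon>) (CA \<epsilon>) G n c)"
    unfolding eps_transition_def eps_rel_transition_def eps_rel_complex_def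
    by (rule \<mu>.connecting_hom_natural[OF G c])
qed

lemmas exact_at_eps =
  pair.exact_at_C[OF G, folded eps_rel_complex_def]
  pair.exact_at_D[OF G, folded eps_rel_complex_def]
  pair.exact_at_Q[OF G, folded eps_rel_complex_def]

lemma exact_at_lc:
  "exact_at (lc_rel_cohomology X A d G n) (lc_from_rel X A d G n)
     (lc_cohomology X d G n) (lc_restriction A d G n) (lc_cohomology A d G n)"
  "exact_at (lc_cohomology X d G n) (lc_restriction A d G n)
     (lc_cohomology A d G n) (lc_connecting X A d G n) (lc_rel_cohomology X A d G (n + 1))"
  "exact_at (lc_cohomology A d G n) (lc_connecting X A d G n)
     (lc_rel_cohomology X A d G (n + 1)) (lc_from_rel X A d G (n + 1)) (lc_cohomology X d G (n + 1))"
  unfolding lc_cohomology_def lc_rel_cohomology_def lc_restriction_def lc_from_rel_def lc_connecting_def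
  by (intro exact_at_direct_limit from_rel_map restriction_map connecting_map exact_at_eps)+

end

theorem mainTheorem6:
  fixes X A :: "'a set" and d :: "'a \<Rightarrow> 'a \<Rightarrow> real" and G :: "'g monoid"
  assumes "Metric_space X d" and "A \<subseteq> X" and "comm_group G"
  shows "\<forall>n :: int.
      exact_at (lc_rel_cohomology X A d G n) (lc_from_rel X A d G n)
               (lc_cohomology X d G n) (lc_restriction A d G n)
               (lc_cohomology A d G n)
    \<and> exact_at (lc_cohomology X d G n) (lc_restriction A d G n)
               (lc_cohomology A d G n) (lc_connecting X A d G n)
               (lc_rel_cohomology X A d G (n + 1))
    \<and> exact_at (lc_cohomology A d G n) (lc_connecting X A d G n)
               (lc_rel_cohomology X A d G (n + 1)) (lc_from_rel X A d G (n + 1))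
               (lc_cohomology X d G (n + 1))"
  using exact_at_lc[OF assms(2,3)] by blast

end
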